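(* Let $\zeta>0$, let $A_i$ denote the Airy function $\mathrm{Ai}$, and let $S_\zeta$ be the operator on $L^2(\zeta,\infty)$ $$(S_\zeta f)(x)=f(x)-\int_\zeta^\infty k(x,t)f(t)\,dt,\qquad k(x,t)=\frac{A_i(x)A_i'(t)-A_i'(x)A_i(t)}{x-t}.$$ Then $S_\zeta$ is positive, invertible and factorable, and the operator $K_\zeta=I-S_\zeta$ belongs to the trace class.
   Context: For $\zeta\le\mu<\infty$ let $(\mathcal P_\mu f)(x)=f(x)$ for $x\ge\mu$ and $(\mathcal P_\mu f)(x)=0$ for $\zeta\le x<\mu$, $f\in L^2(\zeta,\infty)$. An operator $S$ on $L^2(\zeta,\infty)$ is factorable (admits triangular factorization) if $S=S_-^*S_-$ where $S_-$ and $S_-^{-1}$ are bounded on $L^2(\zeta,\infty)$ and $S_-^{\pm1}\mathcal P_\mu=\mathcal P_\mu S_-^{\pm1}\mathcal P_\mu$ for all $\mu$. *)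

theory Defs
  imports "HOL-Analysis.Analysis"
begin

section \<open>Bounded operators on complex \<open>L\<^sup>2\<close> spaces\<close>

text \<open>
  Elements of \<open>L\<^sup>2(M)\<close> are represented by measurable square integrable functions, and two
  representatives stand for the same element iff they agree almost everywhere.  Operators act on
  representatives; all identities between their values are required almost everywhere.
\<close>

definition L2 :: "'a measure \<Rightarrow> ('a \<Rightarrow> complex) set" where
  "L2 M = {f \<in> borel_measurable M. integrable M (\<lambda>x. (cmod (f x))\<^sup>2)}"

definition l2_inner :: "'a measure \<Rightarrow> ('a \<Rightarrow> complex) \<Rightarrow> ('a \<Rightarrow> complex) \<Rightarrow> complex" where
  "l2_inner M f g = (LINT x|M. f x * cnj (g x))"

definition l2_norm :: "'a measure \<Rightarrow> ('a \<Rightarrow> complex) \<Rightarrow> real" where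
  "l2_norm M f = sqrt (LINT x|M. (cmod (f x))\<^sup>2)"

type_synonym 'a l2_op = "('a \<Rightarrow> complex) \<Rightarrow> ('a \<Rightarrow> complex)"

text \<open>
  Linearity and boundedness together imply that a bounded operator maps almost everywhere equal
  functions to almost everywhere equal functions, so that it is well defined on \<open>L\<^sup>2(M)\<close>.
\<close>

definition l2_bounded_op :: "'a measure \<Rightarrow> 'a l2_op \<Rightarrow> bool" where
  "l2_bounded_op M T \<longleftrightarrow>
     (\<forall>f\<in>L2 M. T f \<in> L2 M) \<and>
     (\<forall>f\<in>L2 M. \<forall>g\<in>L2 M. \<forall>a b.
        AE x in M. T (\<lambda>y. a * f y + b * g y) x = a * T f x + b * T g x) \<and>
     (\<exists>C. \<forall>f\<in>L2 M. l2_norm M (T f) \<le> C * l2_norm M f)"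

definition l2_op_eq :: "'a measure \<Rightarrow> 'a l2_op \<Rightarrow> 'a l2_op \<Rightarrow> bool" where
  "l2_op_eq M S T \<longleftrightarrow> (\<forall>f\<in>L2 M. AE x in M. S f x = T f x)"

definition l2_inverse_of :: "'a measure \<Rightarrow> 'a l2_op \<Rightarrow> 'a l2_op \<Rightarrow> bool" where
  "l2_inverse_of M T R \<longleftrightarrow>
     l2_bounded_op M R \<and> l2_op_eq M (T \<circ> R) id \<and> l2_op_eq M (R \<circ> T) id"

definition l2_adjoint_of :: "'a measure \<Rightarrow> 'a l2_op \<Rightarrow> 'a l2_op \<Rightarrow> bool" where
  "l2_adjoint_of M T R \<longleftrightarrow>
     l2_bounded_op M R \<and>
     (\<forall>f\<in>L2 M. \<forall>g\<in>L2 M. l2_inner M (T f) g = l2_inner M f (R g))"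

definition l2_invertible :: "'a measure \<Rightarrow> 'a l2_op \<Rightarrow> bool" where
  "l2_invertible M S \<longleftrightarrow> l2_bounded_op M S \<and> (\<exists>R. l2_inverse_of M S R)"

text \<open>Over the complex numbers, real-valuedness of the quadratic form includes self-adjointness.\<close>

definition l2_positive :: "'a measure \<Rightarrow> 'a l2_op \<Rightarrow> bool" where
  "l2_positive M S \<longleftrightarrow>
     l2_bounded_op M S \<and>
     (\<forall>f\<in>L2 M. l2_inner M (S f) f \<in> \<real> \<and> 0 \<le> Re (l2_inner M (S f) f))"

definition l2_onb :: "'a measure \<Rightarrow> ('a \<Rightarrow> complex) set \<Rightarrow> bool" where
  "l2_onb M B \<longleftrightarrow>
     B \<subseteq> L2 M \<and>
     (\<forall>e\<in>B. \<forall>e'\<in>B. l2_inner M e e' = (if e = e' then 1 else 0)) \<and>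
     (\<forall>f\<in>L2 M. (\<forall>e\<in>B. l2_inner M f e = 0) \<longrightarrow> (AE x in M. f x = 0))"

text \<open>
  The operator \<open>A\<close> below is \<open>|K|\<close>, the unique positive square root of \<open>K\<^sup>*K\<close>.  The sum of the
  \<open>\<langle>|K|e, e\<rangle>\<close> over an orthonormal basis does not depend on the basis, so it is enough to ask for
  its convergence for one of them.
\<close>

definition l2_trace_class :: "'a measure \<Rightarrow> 'a l2_op \<Rightarrow> bool" where
  "l2_trace_class M K \<longleftrightarrow>
     l2_bounded_op M K \<and>
     (\<exists>K' A B. l2_adjoint_of M K K' \<and>
        l2_positive M A \<and> l2_op_eq M (A \<circ> A) (K' \<circ> K) \<and>
        l2_onb M B \<and> (\<lambda>e. Re (l2_inner M (A e) e)) summable_on B)"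


section \<open>Triangular factorization on \<open>L\<^sup>2(\<zeta>, \<infinity>)\<close>\<close>

definition half_line :: "real \<Rightarrow> real measure" where
  "half_line \<zeta> = restrict_space lborel {\<zeta><..}"

definition cutoff :: "real \<Rightarrow> real l2_op" where
  "cutoff \<mu> f = (\<lambda>x. if \<mu> \<le> x then f x else 0)"

definition triangular :: "real \<Rightarrow> real l2_op \<Rightarrow> bool" where
  "triangular \<zeta> T \<longleftrightarrow>
     (\<forall>\<mu>\<ge>\<zeta>. l2_op_eq (half_line \<zeta>) (T \<circ> cutoff \<mu>) (cutoff \<mu> \<circ> T \<circ> cutoff \<mu>))"

definition factorable :: "real \<Rightarrow> real l2_op \<Rightarrow> bool" where
  "factorable \<zeta> S \<longleftrightarrow>
     (\<exists>T T_adj T_inv.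
        l2_bounded_op (half_line \<zeta>) T \<and>
        l2_adjoint_of (half_line \<zeta>) T T_adj \<and>
        l2_inverse_of (half_line \<zeta>) T T_inv \<and>
        l2_op_eq (half_line \<zeta>) S (T_adj \<circ> T) \<and>
        triangular \<zeta> T \<and> triangular \<zeta> T_inv)"


section \<open>The Airy operator\<close>

text \<open>
  The integral converges only conditionally; hence the limit of integrals over bounded intervals.
\<close>

definition airy :: "real \<Rightarrow> real" where
  "airy x = Lim at_top (\<lambda>R. integral {0..R} (\<lambda>t. cos (t ^ 3 / 3 + x * t))) / pi"

text \<open>On the diagonal, a null set, division by zero gives the kernel the irrelevant value 0.\<close>

definition airy_kernel :: "real \<Rightarrow> real \<Rightarrow> real" where
  "airy_kernel x t = (airy x * deriv airy t - deriv airy x * airy t) / (x - t)"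

definition S_op :: "real \<Rightarrow> real l2_op" where
  "S_op \<zeta> f = (\<lambda>x. f x - (LINT t|half_line \<zeta>. of_real (airy_kernel x t) * f t))"

definition K_op :: "real \<Rightarrow> real l2_op" where
  "K_op \<zeta> f = (\<lambda>x. f x - S_op \<zeta> f x)"

end

theory Submission
  imports
    Defs
    "HOL-Complex_Analysis.Cauchy_Integral_Theorem"
    "HOL-Probability.Distributions"
    "HOL-Real_Asymp.Real_Asymp"
begin

text \<open>
  Shifting the contour in the Airy integral to \<open>Im z = 1\<close> turns it into an absolutely convergent
  integral, which yields \<open>\<bar>Ai(x)\<bar> \<le> 3/4 \<cdot> exp(-x)\<close> and the Airy equation.  The latter gives
  \<open>k(x,t) = \<integral> Ai(x+s) Ai(t+s) ds\<close> over \<open>s > 0\<close>, so that \<open>\<bar>k(x,t)\<bar> \<le> 3/8 \<cdot> exp(-x-t)\<close> and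
  \<open>K = A\<^sup>2\<close> for a self-adjoint Hilbert--Schmidt operator \<open>A\<close>; hence \<open>K = \<bar>K\<bar>\<close> is of trace class.
  Because the kernel is so small, the equation \<open>(I + V)\<^sup>* (I + V) = I - K\<close> for a Volterra operator \<open>V\<close>
  can be solved by a contraction on kernels, and \<open>I + V\<close> is inverted by its Volterra resolvent.
\<close>

section \<open>Square integrable functions\<close>

text \<open>Positivity and invertibility alone do not yield a triangular factor for a continuous
  chain of projections, so V has to be constructed, and its equation is quadratic because of the
  product of V with its adjoint. The constants are chosen to fit together. In the weight exp(-x),
  composing two kernels costs the factor \<open>mass\<close>, which is exp(-2 \<zeta>)/2 and so at
  most 1/2. On the ball of kernels bounded by 1/2 exp(-x-t) the quadratic term is at most 1/8
  exp(-x-t); as 3/8 + 1/8 = 1/2, the ball is mapped to itself, with contraction factor 1/2. Such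
  crude bounds allow one contour height for all x instead of a saddle point depending on x. Kernels
  are estimated at every point, so fixed points arise as pointwise limits and supports can be
  recorded by the majorant. The diagonal is the exception: k is 0 there by convention, so identities
  involving k are proved for distinct arguments and reach the operators because a single point is a
  null set. For A to act on the half line from \<zeta>, the variable s is shifted by \<zeta>: its
  kernel is Ai(x + t - \<zeta>).\<close>

lemma integrable_dominated:
  fixes f :: "'a \<Rightarrow> 'b::{banach, second_countable_topology}"
  assumes "integrable M g" "f \<in> borel_measurable M" "\<And>x. x \<in> space M \<Longrightarrow> norm (f x) \<le> g x"
  shows "integrable M f"
  using assms by (intro Bochner_Integration.integrable_bound[OF assms(1,2)] AE_I2)
    (auto intro: order_trans[OF _ abs_ge_self])

lemma norm_integral_le:
  fixes f :: "'a \<Rightarrow> 'b::{banach, second_countable_topology}"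
  assumes "integrable M f" "integrable M g" "\<And>x. x \<in> space M \<Longrightarrow> norm (f x) \<le> g x"
  shows "norm (LINT x|M. f x) \<le> (LINT x|M. g x)"
  using Bochner_Integration.integral_norm_bound[of M f]
    Bochner_Integration.integral_mono[OF integrable_norm[OF assms(1)] assms(2,3)]
  by linarith

lemma borel_measurable_cnj [measurable (raw)]:
  "f \<in> borel_measurable M \<Longrightarrow> (\<lambda>x. cnj (f x)) \<in> borel_measurable M"
  by (rule borel_measurable_continuous_on[of cnj]) (auto intro: continuous_intros)

lemma L2_measurable [measurable_dest]: "f \<in> L2 M \<Longrightarrow> f \<in> borel_measurable M"
  by (simp add: L2_def)

lemma L2_integrable_square: "f \<in> L2 M \<Longrightarrow> integrable M (\<lambda>x. (cmod (f x))\<^sup>2)"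
  by (simp add: L2_def)

lemma L2_integrable_inner:
  assumes "f \<in> L2 M" "g \<in> L2 M"
  shows "integrable M (\<lambda>x. f x * cnj (g x))"
proof (rule Bochner_Integration.integrable_bound)
  show "integrable M (\<lambda>x. (cmod (f x))\<^sup>2 + (cmod (g x))\<^sup>2)"
    using assms by (simp add: L2_integrable_square)
  show "(\<lambda>x. f x * cnj (g x)) \<in> borel_measurable M"
    using assms[THEN L2_measurable] by measurable
  have "cmod (f x) * cmod (g x) \<le> (cmod (f x))\<^sup>2 + (cmod (g x))\<^sup>2" for x
    using sum_squares_bound[of "cmod (f x)" "cmod (g x)"]
      mult_nonneg_nonneg[OF norm_ge_zero[of "f x"] norm_ge_zero[of "g x"]] by linarith
  then show "AE x in M. norm (f x * cnj (g x)) \<le> norm ((cmod (f x))\<^sup>2 + (cmod (g x))\<^sup>2)"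
    by (simp add: norm_mult)
qed

lemma L2_lincomb:
  assumes "f \<in> L2 M" "g \<in> L2 M"
  shows "(\<lambda>x. a * f x + b * g x) \<in> L2 M"
proof -
  note [measurable] = assms[THEN L2_measurable]
  have "integrable M (\<lambda>x. (cmod (a * f x + b * g x))\<^sup>2)"
  proof (rule Bochner_Integration.integrable_bound)
    show "integrable M (\<lambda>x. 2 * (cmod a)\<^sup>2 * (cmod (f x))\<^sup>2 + 2 * (cmod b)\<^sup>2 * (cmod (g x))\<^sup>2)"
      using assms by (simp add: L2_integrable_square)
    show "(\<lambda>x. (cmod (a * f x + b * g x))\<^sup>2) \<in> borel_measurable M" by measurable
    have "(cmod (a * f x + b * g x))\<^sup>2
        \<le> 2 * (cmod a)\<^sup>2 * (cmod (f x))\<^sup>2 + 2 * (cmod b)\<^sup>2 * (cmod (g x))\<^sup>2" for x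
    proof -
      have "(cmod (a * f x + b * g x))\<^sup>2 \<le> (cmod (a * f x) + cmod (b * g x))\<^sup>2"
        by (intro power_mono norm_triangle_ineq) simp
      also have "\<dots> \<le> 2 * (cmod (a * f x))\<^sup>2 + 2 * (cmod (b * g x))\<^sup>2"
        using sum_squares_bound[of "cmod (a * f x)" "cmod (b * g x)"]
        by (simp add: power2_sum)
      finally show ?thesis by (simp add: norm_mult power_mult_distrib)
    qed
    then show "AE x in M. norm ((cmod (a * f x + b * g x))\<^sup>2)
        \<le> norm (2 * (cmod a)\<^sup>2 * (cmod (f x))\<^sup>2 + 2 * (cmod b)\<^sup>2 * (cmod (g x))\<^sup>2)"
      by (auto intro!: order_trans[OF _ abs_ge_self])
  qed
  then show ?thesis by (simp add: L2_def)
qed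

lemma L2_add:
  assumes "f \<in> L2 M" "g \<in> L2 M"
  shows "(\<lambda>x. f x + g x) \<in> L2 M"
  using L2_lincomb[OF assms, of 1 1] by simp

lemma L2_scale: "f \<in> L2 M \<Longrightarrow> (\<lambda>x. a * f x) \<in> L2 M"
  using L2_lincomb[of f M f a 0] by simp

lemma L2_sum:
  assumes "finite F" "\<And>e. e \<in> F \<Longrightarrow> g e \<in> L2 M"
  shows "(\<lambda>x. \<Sum>e\<in>F. g e x) \<in> L2 M"
  using assms
proof (induction F rule: finite_induct)
  case empty
  then show ?case by (simp add: L2_def)
next
  case (insert e F)
  then show ?case by (simp add: L2_add)
qed

section \<open>Inner products, Bessel's inequality and orthonormal bases\<close>

lemma l2_norm_square: "(l2_norm M f)\<^sup>2 = (LINT x|M. (cmod (f x))\<^sup>2)"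
  by (simp add: l2_norm_def)

lemma l2_norm_nonneg: "0 \<le> l2_norm M f"
  by (simp add: l2_norm_def)

lemma l2_inner_self: "l2_inner M f f = of_real ((l2_norm M f)\<^sup>2)"
  by (simp add: l2_inner_def l2_norm_square complex_norm_square[symmetric] flip: of_real_power)

lemma l2_inner_commute: "l2_inner M g f = cnj (l2_inner M f g)"
  unfolding l2_inner_def
  by (subst integral_bounded_linear'[OF bounded_linear_cnj bounded_linear_cnj, symmetric])
     (auto simp: mult.commute)

lemma l2_inner_lincomb_left:
  assumes "f \<in> L2 M" "g \<in> L2 M" "h \<in> L2 M"
  shows "l2_inner M (\<lambda>x. a * f x + b * g x) h = a * l2_inner M f h + b * l2_inner M g h"
  using assms unfolding l2_inner_def
  by (simp add: distrib_right mult.assoc L2_integrable_inner)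

lemma l2_inner_sum_left:
  assumes "finite F" "\<And>e. e \<in> F \<Longrightarrow> g e \<in> L2 M" "h \<in> L2 M"
  shows "l2_inner M (\<lambda>x. \<Sum>e\<in>F. c e * g e x) h = (\<Sum>e\<in>F. c e * l2_inner M (g e) h)"
  using assms unfolding l2_inner_def
  by (simp add: sum_distrib_right mult.assoc L2_integrable_inner Bochner_Integration.integral_sum)

lemma l2_inner_sum_right:
  assumes "finite F" "\<And>e. e \<in> F \<Longrightarrow> g e \<in> L2 M" "h \<in> L2 M"
  shows "l2_inner M h (\<lambda>x. \<Sum>e\<in>F. c e * g e x) = (\<Sum>e\<in>F. cnj (c e) * l2_inner M h (g e))"
  using l2_inner_sum_left[OF assms, where c = c] by (simp add: l2_inner_commute[of M h])

text \<open>The difference of \<open>f\<close> and its projection to the span of \<open>F\<close>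
  has squared norm equal to the right side minus the left side. The order of arguments in
  \<open>l2_inner M e f\<close> fits the later use, where applying a real kernel to \<open>e\<close>
  is pairing \<open>e\<close> with a row of the kernel.\<close>

lemma l2_bessel:
  assumes F: "finite F" "F \<subseteq> L2 M"
    and orth: "\<And>e e'. e \<in> F \<Longrightarrow> e' \<in> F \<Longrightarrow> l2_inner M e e' = (if e = e' then 1 else 0)"
    and f: "f \<in> L2 M"
  shows "(\<Sum>e\<in>F. (cmod (l2_inner M e f))\<^sup>2) \<le> (l2_norm M f)\<^sup>2"
proof -
  define c where "c e = l2_inner M f e" for e
  define p where "p = (\<lambda>x. \<Sum>e\<in>F. c e * e x)"
  have FL: "e \<in> F \<Longrightarrow> e \<in> L2 M" for e using F by auto
  have p: "p \<in> L2 M"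
    unfolding p_def by (intro L2_sum F(1) L2_scale FL)
  have sum_c: "(\<Sum>e\<in>F. cnj (c e) * c e) = of_real (\<Sum>e\<in>F. (cmod (c e))\<^sup>2)"
    by (simp add: complex_norm_square mult.commute del: of_real_power)
  have fp: "l2_inner M f p = of_real (\<Sum>e\<in>F. (cmod (c e))\<^sup>2)"
    unfolding p_def by (subst l2_inner_sum_right) (use F FL f sum_c in \<open>auto simp: c_def\<close>)
  have pf: "l2_inner M p f = of_real (\<Sum>e\<in>F. (cmod (c e))\<^sup>2)"
    by (subst l2_inner_commute) (simp add: fp)
  have ep: "l2_inner M e p = cnj (c e)" if "e \<in> F" for e
  proof -
    have "l2_inner M e p = (\<Sum>e'\<in>F. cnj (c e') * l2_inner M e e')"
      unfolding p_def by (subst l2_inner_sum_right) (use F FL that in auto)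
    also have "\<dots> = (\<Sum>e'\<in>F. if e' = e then cnj (c e) else 0)"
      by (intro sum.cong) (auto simp: orth that)
    finally show ?thesis using F that by simp
  qed
  have pp: "l2_inner M p p = of_real (\<Sum>e\<in>F. (cmod (c e))\<^sup>2)"
  proof -
    have "l2_inner M p p = (\<Sum>e\<in>F. c e * l2_inner M e p)"
      by (subst (1) p_def, subst l2_inner_sum_left) (use F FL p in auto)
    also have "\<dots> = (\<Sum>e\<in>F. cnj (c e) * c e)"
      by (intro sum.cong) (auto simp: ep)
    finally show ?thesis using sum_c by simp
  qed
  define d where "d = (\<lambda>x. 1 * f x + (-1) * p x)"
  have d: "d \<in> L2 M" unfolding d_def by (intro L2_lincomb f p)
  have fd: "l2_inner M f d = l2_inner M f f - l2_inner M f p"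
    by (subst l2_inner_commute, unfold d_def, subst l2_inner_lincomb_left[OF f p f])
       (simp add: l2_inner_commute[of M f f, symmetric] l2_inner_commute[of M f p])
  have pd: "l2_inner M p d = l2_inner M p f - l2_inner M p p"
    by (subst l2_inner_commute, unfold d_def, subst l2_inner_lincomb_left[OF f p p])
       (simp add: l2_inner_commute[of M p p, symmetric] l2_inner_commute[of M p f])
  have "l2_inner M d d = l2_inner M f d - l2_inner M p d"
    by (subst (1) d_def, subst l2_inner_lincomb_left[OF f p d]) simp
  also have "\<dots> = of_real ((l2_norm M f)\<^sup>2 - (\<Sum>e\<in>F. (cmod (c e))\<^sup>2))"
    unfolding fd pd fp pf pp by (simp add: l2_inner_self)
  finally have "(l2_norm M d)\<^sup>2 = (l2_norm M f)\<^sup>2 - (\<Sum>e\<in>F. (cmod (c e))\<^sup>2)"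
    unfolding l2_inner_self of_real_eq_iff .
  then have "(\<Sum>e\<in>F. (cmod (c e))\<^sup>2) \<le> (l2_norm M f)\<^sup>2"
    using zero_le_power2[of "l2_norm M d"] by linarith
  moreover have "cmod (c e) = cmod (l2_inner M e f)" for e
    unfolding c_def by (subst l2_inner_commute) simp
  ultimately show ?thesis by simp
qed

lemma l2_norm_eq_0_imp_AE:
  assumes "f \<in> L2 M" "l2_norm M f = 0"
  shows "AE x in M. f x = 0"
proof -
  have "(LINT x|M. (cmod (f x))\<^sup>2) = 0"
    using assms(2) l2_norm_square[of M f] by simp
  then have "AE x in M. (cmod (f x))\<^sup>2 = 0"
    using integral_nonneg_eq_0_iff_AE[OF L2_integrable_square[OF assms(1)]] by simp
  then show ?thesis by simp
qed

text \<open>Zorn's lemma gives a maximal orthonormal set; a nonzero vector orthogonal to it could be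
  normalized and adjoined. The members are functions, not classes, but orthonormality already
  excludes two representatives of one class, as their inner product would be 1.\<close>

lemma l2_onb_exists: "\<exists>B. l2_onb M B"
proof -
  define orth where "orth B \<longleftrightarrow> B \<subseteq> L2 M \<and>
    (\<forall>e\<in>B. \<forall>e'\<in>B. l2_inner M e e' = (if e = e' then 1 else 0))" for B
  have "\<exists>B\<in>{B. orth B}. \<forall>X\<in>{B. orth B}. B \<subseteq> X \<longrightarrow> X = B"
  proof (rule subset_Zorn', clarsimp)
    fix C assume C: "subset.chain (Collect orth) C"
    show "orth (\<Union>C)" unfolding orth_def
    proof (intro conjI ballI)
      show "\<Union>C \<subseteq> L2 M" using C unfolding subset_chain_def orth_def by blast
      fix e e' assume "e \<in> \<Union>C" "e' \<in> \<Union>C"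
      then obtain X Y where XY: "X \<in> C" "Y \<in> C" "e \<in> X" "e' \<in> Y" by auto
      then have "X \<subseteq> Y \<or> Y \<subseteq> X"
        using C by (meson subset_chain_def)
      then obtain Z where "Z \<in> C" "e \<in> Z" "e' \<in> Z" using XY by auto
      moreover have "orth Z" using C \<open>Z \<in> C\<close> by (auto simp: subset_chain_def)
      ultimately show "l2_inner M e e' = (if e = e' then 1 else 0)"
        by (auto simp: orth_def)
    qed
  qed
  then obtain B where B: "orth B" and max: "\<And>X. orth X \<Longrightarrow> B \<subseteq> X \<Longrightarrow> X = B" by auto
  have "AE x in M. f x = 0" if f: "f \<in> L2 M" and 0: "\<forall>e\<in>B. l2_inner M f e = 0" for f
  proof (cases "l2_norm M f = 0")
    case True
    then show ?thesis using f by (rule l2_norm_eq_0_imp_AE[rotated])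
  next
    case False
    define c :: complex where "c = of_real (inverse (l2_norm M f))"
    define g where "g = (\<lambda>x. c * f x)"
    have g: "g \<in> L2 M" unfolding g_def by (rule L2_scale[OF f])
    have ge: "l2_inner M g h = c * l2_inner M f h" if "h \<in> L2 M" for h
      using l2_inner_lincomb_left[OF f f that, of c 0] by (simp add: g_def)
    have gB: "l2_inner M g e = 0" if "e \<in> B" for e
      using ge[of e] that B 0 by (auto simp: orth_def)
    have gB': "l2_inner M e g = 0" if "e \<in> B" for e
      using gB[OF that] by (subst l2_inner_commute) simp
    have "l2_inner M g g = c * cnj (c * l2_inner M f f)"
      using ge[OF g] ge[OF f] by (subst (asm) (2) l2_inner_commute) simp
    also have "\<dots> = 1"
      using False by (simp add: c_def l2_inner_self field_simps power2_eq_square)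
    finally have gg: "l2_inner M g g = 1" .
    then have "g \<notin> B" using gB by auto
    moreover have "orth (insert g B)"
      using B g gB gB' gg \<open>g \<notin> B\<close> by (auto simp: orth_def)
    ultimately show ?thesis using max[of "insert g B"] by auto
  qed
  then show ?thesis using B unfolding l2_onb_def orth_def by blast
qed

lemma integral_mult_square_le:
  fixes u v :: "'a \<Rightarrow> real"
  assumes [measurable]: "u \<in> borel_measurable M" "v \<in> borel_measurable M"
    and u: "integrable M (\<lambda>x. (u x)\<^sup>2)" and v: "integrable M (\<lambda>x. (v x)\<^sup>2)"
  shows "integrable M (\<lambda>x. u x * v x)"
    and "(LINT x|M. u x * v x)\<^sup>2 \<le> (LINT x|M. (u x)\<^sup>2) * (LINT x|M. (v x)\<^sup>2)"
proof -
  show uv: "integrable M (\<lambda>x. u x * v x)"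
  proof (rule Bochner_Integration.integrable_bound)
    show "integrable M (\<lambda>x. (u x)\<^sup>2 + (v x)\<^sup>2)" using u v by simp
    have "\<bar>u x * v x\<bar> \<le> (u x)\<^sup>2 + (v x)\<^sup>2" for x
      using sum_squares_bound[of "\<bar>u x\<bar>" "\<bar>v x\<bar>"] mult_nonneg_nonneg[of "\<bar>u x\<bar>" "\<bar>v x\<bar>"]
      unfolding abs_mult power2_abs by linarith
    then show "AE x in M. norm (u x * v x) \<le> norm ((u x)\<^sup>2 + (v x)\<^sup>2)" by simp
  qed measurable
  let ?A = "LINT x|M. (u x)\<^sup>2" and ?B = "LINT x|M. u x * v x" and ?C = "LINT x|M. (v x)\<^sup>2"
  have quad: "0 \<le> ?A - 2 * l * ?B + l\<^sup>2 * ?C" for l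
  proof -
    have "0 \<le> (LINT x|M. (u x - l * v x)\<^sup>2)" by simp
    also have "\<dots> = (LINT x|M. (u x)\<^sup>2 - 2 * l * (u x * v x) + l\<^sup>2 * (v x)\<^sup>2)"
      by (intro Bochner_Integration.integral_cong) (auto simp: power2_eq_square algebra_simps)
    also have "\<dots> = ?A - 2 * l * ?B + l\<^sup>2 * ?C" using u v uv by simp
    finally show ?thesis .
  qed
  have "0 \<le> ?C" by simp
  show "?B\<^sup>2 \<le> ?A * ?C"
  proof (cases "?C = 0")
    case True
    have "?B = 0"
    proof (rule ccontr)
      assume "?B \<noteq> 0"
      \<comment> \<open>With \<open>?C = 0\<close> the quadratic is affine in \<open>l\<close>, and
        this choice of \<open>l\<close> gives it the value -1.\<close>
      with quad[of "(?A + 1) / (2 * ?B)"] True show False by simp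
    qed
    then show ?thesis using True by simp
  next
    case False
    with \<open>0 \<le> ?C\<close> have "0 < ?C" by linarith
    \<comment> \<open>The value at \<open>l = ?B / ?C\<close>, where the quadratic is
      smallest.\<close>
    have "?A - 2 * (?B / ?C) * ?B + (?B / ?C)\<^sup>2 * ?C = (?A * ?C - ?B\<^sup>2) / ?C"
      using False by (simp add: field_simps power2_eq_square)
    with quad[of "?B / ?C"] \<open>0 < ?C\<close> show ?thesis
      by (simp add: zero_le_divide_iff)
  qed
qed

text \<open>Serves twice: for S as the product of I + V with its adjoint, and for K as the square of
  the self-adjoint operator A.\<close>

lemma l2_positive_factor:
  assumes S: "l2_bounded_op M S" and T: "l2_bounded_op M T" and adj: "l2_adjoint_of M T R"
    and eq: "l2_op_eq M S (R \<circ> T)"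
  shows "f \<in> L2 M \<Longrightarrow> l2_inner M (S f) f = of_real ((l2_norm M (T f))\<^sup>2)"
    and "l2_positive M S"
proof -
  show *: "l2_inner M (S f) f = of_real ((l2_norm M (T f))\<^sup>2)" if f: "f \<in> L2 M" for f
  proof -
    have Tf: "T f \<in> L2 M" using T f by (simp add: l2_bounded_op_def)
    have RTf: "R (T f) \<in> L2 M" using adj Tf by (simp add: l2_adjoint_of_def l2_bounded_op_def)
    have Sf: "S f \<in> L2 M" using S f by (simp add: l2_bounded_op_def)
    have "l2_inner M (S f) f = l2_inner M (R (T f)) f"
      unfolding l2_inner_def
    proof (rule Bochner_Integration.integral_cong_AE)
      show "AE x in M. S f x * cnj (f x) = R (T f) x * cnj (f x)"
        using eq f by (auto simp: l2_op_eq_def)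
    qed (use L2_integrable_inner[OF Sf f] L2_integrable_inner[OF RTf f] in
        \<open>auto dest: borel_measurable_integrable\<close>)
    also have "\<dots> = cnj (l2_inner M (T f) (T f))"
      using adj f Tf by (subst l2_inner_commute) (simp add: l2_adjoint_of_def)
    finally show ?thesis by (simp add: l2_inner_self)
  qed
  show "l2_positive M S"
    unfolding l2_positive_def using S * by auto
qed

section \<open>Integral operators with kernels dominated by a weight\<close>

definition int_op :: "'a measure \<Rightarrow> ('a \<Rightarrow> 'a \<Rightarrow> real) \<Rightarrow> 'a l2_op" where
  "int_op M k f = (\<lambda>x. LINT t|M. of_real (k x t) * f t)"

definition kernel_comp :: "'a measure \<Rightarrow> ('a \<Rightarrow> 'a \<Rightarrow> real) \<Rightarrow> ('a \<Rightarrow> 'a \<Rightarrow> real) \<Rightarrow> 'a \<Rightarrow> 'a \<Rightarrow> real"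
  where "kernel_comp M k l = (\<lambda>x t. LINT s|M. k x s * l s t)"

text \<open>The majorant \<open>b\<close> is arbitrary so that it may vanish on part of the square:
  a bound by such a \<open>b\<close> forces the kernel to vanish there. The bound holds at every
  point, which makes it stable under pointwise limits.\<close>

definition kernel_bounded ::
    "'a measure \<Rightarrow> ('a \<Rightarrow> 'a \<Rightarrow> real) \<Rightarrow> real \<Rightarrow> ('a \<Rightarrow> 'a \<Rightarrow> real) \<Rightarrow> bool" where
  "kernel_bounded M b D v \<longleftrightarrow> (\<lambda>(x, t). v x t) \<in> borel_measurable (M \<Otimes>\<^sub>M M) \<and>
    (\<forall>x\<in>space M. \<forall>t\<in>space M. \<bar>v x t\<bar> \<le> D * b x t)"

text \<open>Banach's fixed point theorem for the distance "least \<open>d\<close> with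
  \<open>\<bar>u - v\<bar> \<le> d * b\<close>". Stating it with \<open>d\<close> instead of
  dividing by \<open>b\<close> allows zeros of \<open>b\<close>. Completeness amounts to pointwise
  convergence of the iterates started at 0, with the bound and measurability passing to the
  limit.\<close>

lemma kernel_fixed_point:
  fixes b :: "'a \<Rightarrow> 'a \<Rightarrow> real" and \<Phi> :: "('a \<Rightarrow> 'a \<Rightarrow> real) \<Rightarrow> 'a \<Rightarrow> 'a \<Rightarrow> real"
  assumes b: "\<And>x t. x \<in> space M \<Longrightarrow> t \<in> space M \<Longrightarrow> 0 \<le> b x t"
    and q: "0 \<le> q" "q < 1" and D: "0 \<le> D"
    and maps: "\<And>v. kernel_bounded M b D v \<Longrightarrow> kernel_bounded M b D (\<Phi> v)"
    and contr: "\<And>u v d. kernel_bounded M b D u \<Longrightarrow> kernel_bounded M b D v \<Longrightarrow> 0 \<le> d \<Longrightarrow>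
      (\<forall>x\<in>space M. \<forall>t\<in>space M. \<bar>u x t - v x t\<bar> \<le> d * b x t) \<Longrightarrow>
      (\<forall>x\<in>space M. \<forall>t\<in>space M. \<bar>\<Phi> u x t - \<Phi> v x t\<bar> \<le> q * d * b x t)"
  obtains v where "kernel_bounded M b D v" "\<And>x t. x \<in> space M \<Longrightarrow> t \<in> space M \<Longrightarrow> \<Phi> v x t = v x t"
proof -
  define u where "u n = (\<Phi> ^^ n) (\<lambda>_ _. 0)" for n
  have u_Suc: "u (Suc n) = \<Phi> (u n)" for n by (simp add: u_def)
  have u_bdd: "kernel_bounded M b D (u n)" for n
  proof (induction n)
    case 0
    then show ?case using b D by (simp add: u_def kernel_bounded_def)
  next
    case (Suc n)
    then show ?case by (simp add: u_Suc maps)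
  qed
  have step: "\<forall>x\<in>space M. \<forall>t\<in>space M. \<bar>u (Suc n) x t - u n x t\<bar> \<le> q ^ n * D * b x t" for n
  proof (induction n)
    case 0
    then show ?case using u_bdd[of 1] by (simp add: u_def kernel_bounded_def)
  next
    case (Suc n)
    then show ?case using contr[OF u_bdd u_bdd, of "q ^ n * D" "Suc n" n] q D
      by (simp add: u_Suc mult.assoc)
  qed
  \<comment> \<open>The sum of the geometric series of the step bounds
    \<open>q ^ n * D\<close>.\<close>
  define C where "C = D / (1 - q)"
  have C: "0 \<le> C" using q D by (simp add: C_def)
  \<comment> \<open>The exact partial sum is kept because an induction on \<open>m\<close> with the
    cruder bound \<open>q ^ n * C\<close> would not close.\<close>
  have diff: "\<bar>u (n + m) x t - u n x t\<bar> \<le> (q ^ n - q ^ (n + m)) * C * b x t"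
    if "x \<in> space M" "t \<in> space M" for n m x t
  proof (induction m)
    case 0
    then show ?case by simp
  next
    case (Suc m)
    have "\<bar>u (n + Suc m) x t - u n x t\<bar>
        \<le> q ^ (n + m) * D * b x t + (q ^ n - q ^ (n + m)) * C * b x t"
      using step[of "n + m"] that Suc by fastforce
    also have "\<dots> = (q ^ n - q ^ (n + Suc m)) * C * b x t"
      using q by (simp add: C_def field_simps)
    finally show ?case .
  qed
  have diff': "\<bar>u (n + m) x t - u n x t\<bar> \<le> q ^ n * (C * b x t)"
    if "x \<in> space M" "t \<in> space M" for n m x t
  proof -
    have "(q ^ n - q ^ (n + m)) * C * b x t \<le> q ^ n * C * b x t"
      using q C b[OF that] by (intro mult_right_mono) auto
    then show ?thesis using diff[OF that, of n m] by (simp add: mult.assoc)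
  qed
  have q_lim: "(\<lambda>n. q ^ n * c) \<longlonglongrightarrow> 0" for c
    using tendsto_mult_right[OF LIMSEQ_realpow_zero[OF q], of c] by simp
  have conv: "convergent (\<lambda>n. u n x t)" if xt: "x \<in> space M" "t \<in> space M" for x t
  proof -
    have "Cauchy (\<lambda>n. u n x t)"
    proof (rule CauchyI')
      fix e :: real assume "0 < e"
      with q_lim[of "C * b x t"] obtain N where N: "\<And>n. n \<ge> N \<Longrightarrow> \<bar>q ^ n * (C * b x t)\<bar> < e"
        by (auto simp: LIMSEQ_iff)
      show "\<exists>N. \<forall>m\<ge>N. \<forall>n>m. dist (u m x t) (u n x t) < e"
      proof (intro exI[of _ N] allI impI)
        fix m n assume "N \<le> m" "m < n"
        then show "dist (u m x t) (u n x t) < e"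
          using diff'[OF xt, of m "n - m"] N[of m] by (simp add: dist_real_def abs_minus_commute)
      qed
    qed
    then show ?thesis by (rule Cauchy_convergent)
  qed
  define v where "v x t = lim (\<lambda>n. u n x t)" for x t
  have lim: "(\<lambda>n. u n x t) \<longlonglongrightarrow> v x t" if "x \<in> space M" "t \<in> space M" for x t
    using conv[OF that] by (simp add: v_def convergent_LIMSEQ_iff)
  have tail: "\<bar>v x t - u n x t\<bar> \<le> q ^ n * (C * b x t)" if xt: "x \<in> space M" "t \<in> space M" for n x t
  proof (rule LIMSEQ_le_const2)
    show "(\<lambda>m. \<bar>u (m + n) x t - u n x t\<bar>) \<longlonglongrightarrow> \<bar>v x t - u n x t\<bar>"
      by (intro tendsto_intros LIMSEQ_ignore_initial_segment lim xt)
    show "\<exists>N. \<forall>m\<ge>N. \<bar>u (m + n) x t - u n x t\<bar> \<le> q ^ n * (C * b x t)"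
      using diff'[OF xt, of n] by (simp add: add.commute)
  qed
  have v_bdd: "kernel_bounded M b D v"
    unfolding kernel_bounded_def
  proof (intro conjI ballI)
    have "(\<lambda>p. lim (\<lambda>n. (\<lambda>(x, t). u n x t) p)) \<in> borel_measurable (M \<Otimes>\<^sub>M M)"
      using u_bdd unfolding kernel_bounded_def by (intro borel_measurable_lim_metric) blast
    then show "(\<lambda>(x, t). v x t) \<in> borel_measurable (M \<Otimes>\<^sub>M M)"
      by (simp add: v_def case_prod_beta')
    show "\<bar>v x t\<bar> \<le> D * b x t" if "x \<in> space M" "t \<in> space M" for x t
      using u_bdd that
      by (intro LIMSEQ_le_const2[OF tendsto_rabs[OF lim[OF that]]]) (auto simp: kernel_bounded_def)
  qed
  \<comment> \<open>Contractivity compares \<open>\<Phi> v\<close> with \<open>\<Phi> (u n)\<close>,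
    which is the next iterate, so \<open>\<Phi> v\<close> and \<open>v\<close> are limits of the
    same sequence.\<close>
  have "\<Phi> v x t = v x t" if xt: "x \<in> space M" "t \<in> space M" for x t
  proof -
    have "\<bar>\<Phi> v y s - \<Phi> (u n) y s\<bar> \<le> q * (q ^ n * C) * b y s"
      if "y \<in> space M" "s \<in> space M" for n y s
      using contr[OF v_bdd u_bdd, of "q ^ n * C" n] tail q C that by (simp add: mult.assoc)
    then have "norm (\<Phi> v x t - u (Suc n) x t) \<le> q ^ Suc n * (C * b x t)" for n
      using xt by (simp add: u_Suc mult.assoc)
    then have le: "\<forall>\<^sub>F n in sequentially. norm (\<Phi> v x t - u (Suc n) x t) \<le> q ^ Suc n * (C * b x t)"
      by (intro always_eventually) blast
    have "(\<lambda>n. q ^ Suc n * (C * b x t)) \<longlonglongrightarrow> 0"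
      using LIMSEQ_Suc[OF q_lim] by simp
    with le have "(\<lambda>n. \<Phi> v x t - u (Suc n) x t) \<longlonglongrightarrow> 0"
      by (rule Lim_null_comparison)
    moreover have "(\<lambda>n. \<Phi> v x t - u (Suc n) x t) \<longlonglongrightarrow> \<Phi> v x t - v x t"
      by (intro tendsto_intros LIMSEQ_Suc lim xt)
    ultimately have "\<Phi> v x t - v x t = 0" by (rule LIMSEQ_unique[rotated])
    then show ?thesis by simp
  qed
  with v_bdd show ?thesis by (rule that)
qed

text \<open>A kernel bounded by D w(x) w(t) is majorized by a rank one kernel whose operator norm is
  D times the integral of w squared. All estimates for operators and compositions therefore reduce
  to that single number, \<open>mass\<close>.\<close>

locale weighted_space = sigma_finite_measure M for M :: "'a measure" +
  fixes w :: "'a \<Rightarrow> real"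
  assumes w_measurable [measurable]: "w \<in> borel_measurable M"
    and w_nonneg: "x \<in> space M \<Longrightarrow> 0 \<le> w x"
    and w_square_integrable: "integrable M (\<lambda>x. (w x)\<^sup>2)"
begin

sublocale pair_sigma_finite M M ..

definition mass :: real where
  "mass = (LINT x|M. (w x)\<^sup>2)"

abbreviation dominated :: "real \<Rightarrow> ('a \<Rightarrow> 'a \<Rightarrow> real) \<Rightarrow> bool" where
  "dominated \<equiv> kernel_bounded M (\<lambda>x t. w x * w t)"

lemma mass_nonneg: "0 \<le> mass"
  by (simp add: mass_def)

lemma kernel_bounded_measurable:
  assumes "kernel_bounded M b D k" "f \<in> measurable N M" "g \<in> measurable N M"
  shows "(\<lambda>p. k (f p) (g p)) \<in> borel_measurable N"
proof -
  have [measurable]: "(\<lambda>(x, t). k x t) \<in> borel_measurable (M \<Otimes>\<^sub>M M)"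
    using assms(1) by (simp add: kernel_bounded_def)
  note [measurable] = assms(2,3)
  have "(\<lambda>p. (\<lambda>(x, t). k x t) (f p, g p)) \<in> borel_measurable N" by measurable
  then show ?thesis by simp
qed

lemma kernel_boundedD:
  "kernel_bounded M b D k \<Longrightarrow> x \<in> space M \<Longrightarrow> t \<in> space M \<Longrightarrow> \<bar>k x t\<bar> \<le> D * b x t"
  by (simp add: kernel_bounded_def)

lemma dominated_transpose:
  assumes "dominated D k"
  shows "dominated D (\<lambda>x t. k t x)"
  unfolding kernel_bounded_def case_prod_beta'
proof (intro conjI ballI)
  show "\<bar>k t x\<bar> \<le> D * (w x * w t)" if "x \<in> space M" "t \<in> space M" for x t
    using kernel_boundedD[OF assms that(2,1)] by (simp add: mult.commute)
qed (rule kernel_bounded_measurable[OF assms measurable_snd measurable_fst])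

section \<open>Action of dominated kernels on square integrable functions\<close>

lemma weight_L2:
  assumes "f \<in> L2 M"
  shows "integrable M (\<lambda>t. w t * cmod (f t))"
    and "(LINT t|M. w t * cmod (f t))\<^sup>2 \<le> mass * (l2_norm M f)\<^sup>2"
  using integral_mult_square_le[OF w_measurable _ w_square_integrable L2_integrable_square[OF assms]]
    L2_measurable[OF assms]
  by (simp_all add: mass_def l2_norm_square)

lemma int_op_integrable:
  assumes k: "dominated D k" and f: "f \<in> L2 M" and x: "x \<in> space M"
  shows "integrable M (\<lambda>t. of_real (k x t) * f t)"
proof (rule integrable_dominated)
  show "integrable M (\<lambda>t. D * w x * (w t * cmod (f t)))"
    using weight_L2[OF f] by simp
  note [measurable] = kernel_bounded_measurable[OF k] L2_measurable[OF f]
  show "(\<lambda>t. of_real (k x t) * f t) \<in> borel_measurable M" using x by measurable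
  show "norm (of_real (k x t) * f t) \<le> D * w x * (w t * cmod (f t))" if "t \<in> space M" for t
    using mult_right_mono[OF kernel_boundedD[OF k x that] norm_ge_zero[of "f t"]]
    by (simp add: norm_mult ac_simps)
qed

lemma int_op_bound:
  assumes k: "dominated D k" and f: "f \<in> L2 M" and x: "x \<in> space M"
  shows "cmod (int_op M k f x) \<le> D * w x * (LINT t|M. w t * cmod (f t))"
proof -
  have "cmod (int_op M k f x) \<le> (LINT t|M. D * w x * (w t * cmod (f t)))"
    unfolding int_op_def
  proof (rule norm_integral_le)
    show "norm (of_real (k x t) * f t) \<le> D * w x * (w t * cmod (f t))" if "t \<in> space M" for t
      using mult_right_mono[OF kernel_boundedD[OF k x that] norm_ge_zero[of "f t"]]
      by (simp add: norm_mult ac_simps)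
  qed (use weight_L2[OF f] int_op_integrable[OF k f x] in auto)
  then show ?thesis by simp
qed

lemma int_op_L2:
  assumes k: "dominated D k" and f: "f \<in> L2 M"
  shows "int_op M k f \<in> L2 M" and "(l2_norm M (int_op M k f))\<^sup>2 \<le> (D * mass)\<^sup>2 * (l2_norm M f)\<^sup>2"
proof -
  let ?I = "LINT t|M. w t * cmod (f t)"
  note [measurable] = kernel_bounded_measurable[OF k] L2_measurable[OF f]
  have meas [measurable]: "int_op M k f \<in> borel_measurable M"
    unfolding int_op_def by measurable
  have le: "(cmod (int_op M k f x))\<^sup>2 \<le> (D * ?I)\<^sup>2 * (w x)\<^sup>2" if "x \<in> space M" for x
    using power_mono[OF int_op_bound[OF k f that] norm_ge_zero, of 2]
    by (simp add: power_mult_distrib ac_simps)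
  have int: "integrable M (\<lambda>x. (cmod (int_op M k f x))\<^sup>2)"
    using le by (intro integrable_dominated[OF integrable_mult_right[OF w_square_integrable]]) auto
  then show "int_op M k f \<in> L2 M" by (simp add: L2_def)
  have "(l2_norm M (int_op M k f))\<^sup>2 \<le> (LINT x|M. (D * ?I)\<^sup>2 * (w x)\<^sup>2)"
    unfolding l2_norm_square using le int w_square_integrable
    by (intro Bochner_Integration.integral_mono) auto
  also have "\<dots> = D\<^sup>2 * mass * ?I\<^sup>2"
    by (simp add: mass_def power_mult_distrib)
  also have "\<dots> \<le> D\<^sup>2 * mass * (mass * (l2_norm M f)\<^sup>2)"
    by (intro mult_left_mono weight_L2 f) (simp add: mass_nonneg)
  finally show "(l2_norm M (int_op M k f))\<^sup>2 \<le> (D * mass)\<^sup>2 * (l2_norm M f)\<^sup>2"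
    by (simp add: power_mult_distrib power2_eq_square ac_simps)
qed

lemma int_op_norm_le:
  assumes "dominated D k" "f \<in> L2 M"
  shows "l2_norm M (int_op M k f) \<le> \<bar>D * mass\<bar> * l2_norm M f"
proof (rule power2_le_imp_le)
  show "(l2_norm M (int_op M k f))\<^sup>2 \<le> (\<bar>D * mass\<bar> * l2_norm M f)\<^sup>2"
    using int_op_L2(2)[OF assms] unfolding power_mult_distrib power2_abs .
qed (simp add: l2_norm_nonneg)

lemma int_op_lincomb:
  assumes "dominated D k" "f \<in> L2 M" "g \<in> L2 M" "x \<in> space M"
  shows "int_op M k (\<lambda>y. a * f y + b * g y) x = a * int_op M k f x + b * int_op M k g x"
proof -
  have "int_op M k (\<lambda>y. a * f y + b * g y) x
      = (LINT t|M. a * (of_real (k x t) * f t) + b * (of_real (k x t) * g t))"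
    unfolding int_op_def by (intro Bochner_Integration.integral_cong) (auto simp: algebra_simps)
  then show ?thesis
    using int_op_integrable[OF assms(1,2,4)] int_op_integrable[OF assms(1,3,4)]
    by (simp add: int_op_def)
qed

section \<open>Composition, adjoints and the Hilbert-Schmidt bound\<close>

lemma integrable_tensor:
  fixes u v :: "'a \<Rightarrow> real"
  assumes "integrable M u" "integrable M v"
  shows "integrable (M \<Otimes>\<^sub>M M) (\<lambda>(s, t). u s * v t)"
proof (rule Fubini_integrable)
  note [measurable] = assms[THEN borel_measurable_integrable]
  show "(\<lambda>(s, t). u s * v t) \<in> borel_measurable (M \<Otimes>\<^sub>M M)" by measurable
qed (use assms in \<open>auto simp: abs_mult\<close>)

lemma kernel_comp_integrable:
  assumes k: "dominated C k" and l: "dominated D l" and C: "0 \<le> C" and D: "0 \<le> D"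
    and x: "x \<in> space M" and t: "t \<in> space M"
  shows "integrable M (\<lambda>s. k x s * l s t)"
    and "\<bar>kernel_comp M k l x t\<bar> \<le> C * D * mass * (w x * w t)"
proof -
  note [measurable] = kernel_bounded_measurable[OF k] kernel_bounded_measurable[OF l]
  have le: "\<bar>k x s * l s t\<bar> \<le> C * D * (w x * w t) * (w s)\<^sup>2" if s: "s \<in> space M" for s
    using mult_mono[OF kernel_boundedD[OF k x s] kernel_boundedD[OF l s t]] C w_nonneg[OF x] w_nonneg[OF s]
    by (simp add: abs_mult power2_eq_square ac_simps)
  show int: "integrable M (\<lambda>s. k x s * l s t)"
  proof (rule integrable_dominated)
    show "integrable M (\<lambda>s. C * D * (w x * w t) * (w s)\<^sup>2)" using w_square_integrable by simp
    show "(\<lambda>s. k x s * l s t) \<in> borel_measurable M" using x t by measurable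
  qed (use le in simp)
  have "\<bar>kernel_comp M k l x t\<bar> \<le> (LINT s|M. C * D * (w x * w t) * (w s)\<^sup>2)"
    unfolding kernel_comp_def real_norm_def[symmetric]
    using le int w_square_integrable by (intro norm_integral_le) auto
  then show "\<bar>kernel_comp M k l x t\<bar> \<le> C * D * mass * (w x * w t)"
    by (simp add: mass_def ac_simps)
qed

text \<open>The two majorants are left general because the fixed point iterations compose kernels
  whose bound also carries a support.\<close>

lemma kernel_comp_measurable:
  assumes k: "kernel_bounded M b C k" and l: "kernel_bounded M b' D l"
  shows "(\<lambda>(x, t). kernel_comp M k l x t) \<in> borel_measurable (M \<Otimes>\<^sub>M M)"
proof -
  note [measurable] = kernel_bounded_measurable[OF k] kernel_bounded_measurable[OF l]
  show ?thesis unfolding kernel_comp_def by measurable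
qed

lemma dominated_comp:
  assumes "dominated C k" "dominated D l" "0 \<le> C" "0 \<le> D"
  shows "dominated (C * D * mass) (kernel_comp M k l)"
  unfolding kernel_bounded_def
  using kernel_comp_measurable[OF assms(1,2)] kernel_comp_integrable(2)[OF assms] by auto

lemma dominated_add:
  assumes k: "dominated C k" and l: "dominated D l"
  shows "dominated (C + D) (\<lambda>x t. k x t + l x t)"
  unfolding kernel_bounded_def
proof (intro conjI ballI)
  note [measurable] = kernel_bounded_measurable[OF k] kernel_bounded_measurable[OF l]
  show "(\<lambda>(x, t). k x t + l x t) \<in> borel_measurable (M \<Otimes>\<^sub>M M)" by measurable
  fix x t assume "x \<in> space M" "t \<in> space M"
  from kernel_boundedD[OF k this] kernel_boundedD[OF l this]
  show "\<bar>k x t + l x t\<bar> \<le> (C + D) * (w x * w t)"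
    by (simp add: distrib_right)
qed

lemma int_op_add:
  assumes "dominated C k" "dominated D l" "f \<in> L2 M" "x \<in> space M"
  shows "int_op M (\<lambda>x t. k x t + l x t) f x = int_op M k f x + int_op M l f x"
  using int_op_integrable[OF assms(1,3,4)] int_op_integrable[OF assms(2,3,4)]
  by (simp add: int_op_def distrib_right)

text \<open>Fubini's theorem, with a majorant that is a product of a multiple of w(s) squared and of
  w(t) |f(t)|.\<close>

lemma int_op_comp:
  assumes k: "dominated C k" and l: "dominated D l" and C: "0 \<le> C" and D: "0 \<le> D"
    and f: "f \<in> L2 M" and x: "x \<in> space M"
  shows "int_op M k (int_op M l f) x = int_op M (kernel_comp M k l) f x"
proof -
  define h where "h s t = of_real (k x s) * (of_real (l s t) * f t)" for s t
  note [measurable] = kernel_bounded_measurable[OF k] kernel_bounded_measurable[OF l] L2_measurable[OF f]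
  have int: "integrable (M \<Otimes>\<^sub>M M) (\<lambda>(s, t). h s t)"
  proof (rule integrable_dominated)
    show "integrable (M \<Otimes>\<^sub>M M) (\<lambda>(s, t). (C * D * w x * (w s)\<^sup>2) * (w t * cmod (f t)))"
      using weight_L2[OF f] w_square_integrable by (intro integrable_tensor) auto
    show "(\<lambda>(s, t). h s t) \<in> borel_measurable (M \<Otimes>\<^sub>M M)"
      unfolding h_def using x by measurable
    have "norm (h s t) \<le> C * D * w x * (w s)\<^sup>2 * (w t * cmod (f t))"
      if s: "s \<in> space M" and t: "t \<in> space M" for s t
    proof -
      have "\<bar>k x s\<bar> * \<bar>l s t\<bar> \<le> (C * (w x * w s)) * (D * (w s * w t))"
        using C w_nonneg[OF x] w_nonneg[OF s] w_nonneg[OF t] D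
        by (intro mult_mono kernel_boundedD[OF k x s] kernel_boundedD[OF l s t]) auto
      from mult_right_mono[OF this norm_ge_zero[of "f t"]] show ?thesis
        by (simp add: h_def norm_mult power2_eq_square ac_simps)
    qed
    then show "norm (case p of (s, t) \<Rightarrow> h s t)
        \<le> (case p of (s, t) \<Rightarrow> (C * D * w x * (w s)\<^sup>2) * (w t * cmod (f t)))"
      if "p \<in> space (M \<Otimes>\<^sub>M M)" for p
      using that by (auto simp: space_pair_measure)
  qed
  have "int_op M k (int_op M l f) x = (LINT s|M. LINT t|M. h s t)"
    by (simp add: int_op_def h_def)
  also have "\<dots> = (LINT t|M. LINT s|M. h s t)"
    by (rule Fubini_integral[OF int, symmetric])
  also have "\<dots> = (LINT t|M. of_real (kernel_comp M k l x t) * f t)"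
  proof (rule Bochner_Integration.integral_cong)
    fix t assume t: "t \<in> space M"
    have "(LINT s|M. h s t) = (LINT s|M. of_real (k x s * l s t) * f t)"
      by (simp add: h_def mult.assoc)
    also have "\<dots> = of_real (kernel_comp M k l x t) * f t"
      using kernel_comp_integrable(1)[OF k l C D x t] by (simp add: kernel_comp_def del: of_real_mult)
    finally show "(LINT s|M. h s t) = of_real (kernel_comp M k l x t) * f t" .
  qed simp
  finally show ?thesis by (simp add: int_op_def)
qed

text \<open>The kernel is real, so the adjoint has the transposed kernel without conjugation.
  Fubini's theorem applies with the product of w |g| and w |f| as majorant.\<close>

lemma int_op_adjoint:
  assumes k: "dominated D k" and D: "0 \<le> D" and f: "f \<in> L2 M" and g: "g \<in> L2 M"
  shows "l2_inner M (int_op M k f) g = l2_inner M f (int_op M (\<lambda>x t. k t x) g)"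
proof -
  define h where "h x t = of_real (k x t) * f t * cnj (g x)" for x t
  note [measurable] = kernel_bounded_measurable[OF k] L2_measurable[OF f] L2_measurable[OF g]
  have int: "integrable (M \<Otimes>\<^sub>M M) (\<lambda>(x, t). h x t)"
  proof (rule integrable_dominated)
    show "integrable (M \<Otimes>\<^sub>M M) (\<lambda>(x, t). (D * (w x * cmod (g x))) * (w t * cmod (f t)))"
      using weight_L2[OF f] weight_L2[OF g] by (intro integrable_tensor) auto
    show "(\<lambda>(x, t). h x t) \<in> borel_measurable (M \<Otimes>\<^sub>M M)"
      unfolding h_def by measurable
    have "norm (h x t) \<le> D * (w x * cmod (g x)) * (w t * cmod (f t))"
      if x: "x \<in> space M" and t: "t \<in> space M" for x t
      using mult_right_mono[OF kernel_boundedD[OF k x t], of "cmod (f t) * cmod (g x)"]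
      by (simp add: h_def norm_mult ac_simps)
    then show "norm (case p of (x, t) \<Rightarrow> h x t)
        \<le> (case p of (x, t) \<Rightarrow> (D * (w x * cmod (g x))) * (w t * cmod (f t)))"
      if "p \<in> space (M \<Otimes>\<^sub>M M)" for p
      using that by (auto simp: space_pair_measure)
  qed
  have "l2_inner M (int_op M k f) g = (LINT x|M. LINT t|M. h x t)"
    by (simp add: l2_inner_def int_op_def h_def)
  also have "\<dots> = (LINT t|M. LINT x|M. h x t)"
    by (rule Fubini_integral[OF int, symmetric])
  also have "\<dots> = (LINT t|M. f t * cnj (int_op M (\<lambda>x t. k t x) g t))"
  proof (rule Bochner_Integration.integral_cong)
    fix t assume t: "t \<in> space M"
    have "(LINT x|M. h x t) = (LINT x|M. f t * cnj (of_real (k x t) * g x))"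
      by (simp add: h_def ac_simps)
    also have "\<dots> = f t * (LINT x|M. cnj (of_real (k x t) * g x))"
      by (rule integral_mult_right_zero)
    also have "(LINT x|M. cnj (of_real (k x t) * g x)) = cnj (int_op M (\<lambda>x t. k t x) g t)"
      unfolding int_op_def
      by (rule integral_bounded_linear'[OF bounded_linear_cnj bounded_linear_cnj]) simp
    finally show "(LINT x|M. h x t) = f t * cnj (int_op M (\<lambda>x t. k t x) g t)" .
  qed simp
  finally show ?thesis by (simp add: l2_inner_def)
qed

text \<open>For fixed \<open>x\<close>, the value of the image of \<open>e\<close> is the inner
  product of \<open>e\<close> with the real function k(x, .). Bessel's inequality bounds the sum
  over \<open>F\<close> by the squared norm of that row, and integrating over \<open>x\<close> gives
  a bound that does not depend on \<open>F\<close>.\<close>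

lemma int_op_hilbert_schmidt:
  assumes k: "dominated D k" and D: "0 \<le> D" and F: "finite F" "F \<subseteq> L2 M"
    and orth: "\<And>e e'. e \<in> F \<Longrightarrow> e' \<in> F \<Longrightarrow> l2_inner M e e' = (if e = e' then 1 else 0)"
  shows "(\<Sum>e\<in>F. (l2_norm M (int_op M k e))\<^sup>2) \<le> (D * mass)\<^sup>2"
proof -
  note [measurable] = kernel_bounded_measurable[OF k]
  have FL: "e \<in> F \<Longrightarrow> e \<in> L2 M" for e using F by auto
  have row: "(\<Sum>e\<in>F. (cmod (int_op M k e x))\<^sup>2) \<le> D\<^sup>2 * mass * (w x)\<^sup>2" if x: "x \<in> space M" for x
  proof -
    define g where "g t = complex_of_real (k x t)" for t
    have le: "(cmod (g t))\<^sup>2 \<le> D\<^sup>2 * (w x)\<^sup>2 * (w t)\<^sup>2" if "t \<in> space M" for t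
      using power_mono[OF kernel_boundedD[OF k x that] abs_ge_zero, of 2]
      by (simp add: g_def power_mult_distrib ac_simps)
    have "g \<in> borel_measurable M" unfolding g_def using x by measurable
    have int: "integrable M (\<lambda>t. (cmod (g t))\<^sup>2)"
      using le \<open>g \<in> borel_measurable M\<close>
      by (intro integrable_dominated[OF integrable_mult_right[OF w_square_integrable]]) auto
    with \<open>g \<in> borel_measurable M\<close> have g: "g \<in> L2 M" by (simp add: L2_def)
    have "(\<Sum>e\<in>F. (cmod (int_op M k e x))\<^sup>2) = (\<Sum>e\<in>F. (cmod (l2_inner M e g))\<^sup>2)"
      by (simp add: int_op_def l2_inner_def g_def mult.commute)
    also have "\<dots> \<le> (l2_norm M g)\<^sup>2" by (rule l2_bessel[OF F orth g])
    also have "\<dots> \<le> (LINT t|M. D\<^sup>2 * (w x)\<^sup>2 * (w t)\<^sup>2)"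
      unfolding l2_norm_square using int le w_square_integrable
      by (intro Bochner_Integration.integral_mono) auto
    finally show ?thesis by (simp add: mass_def ac_simps)
  qed
  have "(\<Sum>e\<in>F. (l2_norm M (int_op M k e))\<^sup>2) = (LINT x|M. (\<Sum>e\<in>F. (cmod (int_op M k e x))\<^sup>2))"
    unfolding l2_norm_square
    by (rule Bochner_Integration.integral_sum[symmetric]) (rule L2_integrable_square[OF int_op_L2(1)[OF k FL]])
  also have "\<dots> \<le> (LINT x|M. D\<^sup>2 * mass * (w x)\<^sup>2)"
    using row w_square_integrable
    by (intro Bochner_Integration.integral_mono Bochner_Integration.integrable_sum
          L2_integrable_square[OF int_op_L2(1)[OF k FL]]) auto
  also have "\<dots> = D\<^sup>2 * mass * mass" by (simp add: mass_def)
  finally show ?thesis by (simp add: power_mult_distrib power2_eq_square ac_simps)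
qed

lemma int_op_bounded:
  assumes k: "dominated D k"
  shows "l2_bounded_op M (int_op M k)"
  unfolding l2_bounded_op_def
proof (intro conjI ballI allI exI)
  fix f g assume f: "f \<in> L2 M" and g: "g \<in> L2 M"
  show "int_op M k f \<in> L2 M" by (rule int_op_L2[OF k f])
  show "AE x in M. int_op M k (\<lambda>y. a * f y + b * g y) x = a * int_op M k f x + b * int_op M k g x" for a b
    by (intro AE_I2 int_op_lincomb[OF k f g])
  show "l2_norm M (int_op M k f) \<le> \<bar>D * mass\<bar> * l2_norm M f" by (rule int_op_norm_le[OF k f])
qed

section \<open>Perturbations of the identity and their inverses\<close>

definition id_plus :: "('a \<Rightarrow> 'a \<Rightarrow> real) \<Rightarrow> 'a l2_op" where
  "id_plus k f = (\<lambda>x. f x + int_op M k f x)"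

lemma id_plus_bounded:
  assumes k: "dominated D k"
  shows "l2_bounded_op M (id_plus k)"
  unfolding l2_bounded_op_def
proof (intro conjI ballI allI exI)
  fix f g assume f: "f \<in> L2 M" and g: "g \<in> L2 M"
  show "id_plus k f \<in> L2 M"
    unfolding id_plus_def by (intro L2_add f int_op_L2[OF k])
  show "AE x in M. id_plus k (\<lambda>y. a * f y + b * g y) x = a * id_plus k f x + b * id_plus k g x" for a b
    by (intro AE_I2) (simp add: id_plus_def int_op_lincomb[OF k f g] algebra_simps)
next
  fix f assume f: "f \<in> L2 M"
  have L: "integrable M (\<lambda>x. (cmod (id_plus k f x))\<^sup>2)"
    unfolding id_plus_def by (intro L2_integrable_square L2_add f int_op_L2[OF k])
  have "(l2_norm M (id_plus k f))\<^sup>2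
      \<le> (LINT x|M. 2 * (cmod (f x))\<^sup>2 + 2 * (cmod (int_op M k f x))\<^sup>2)"
    unfolding l2_norm_square
  proof (rule Bochner_Integration.integral_mono)
    show "integrable M (\<lambda>x. 2 * (cmod (f x))\<^sup>2 + 2 * (cmod (int_op M k f x))\<^sup>2)"
      using f int_op_L2(1)[OF k f] by (simp add: L2_integrable_square)
    fix x
    have "(cmod (id_plus k f x))\<^sup>2 \<le> (cmod (f x) + cmod (int_op M k f x))\<^sup>2"
      unfolding id_plus_def by (intro power_mono norm_triangle_ineq) simp
    also have "\<dots> \<le> 2 * (cmod (f x))\<^sup>2 + 2 * (cmod (int_op M k f x))\<^sup>2"
      using sum_squares_bound[of "cmod (f x)" "cmod (int_op M k f x)"] by (simp add: power2_sum)
    finally show "(cmod (id_plus k f x))\<^sup>2 \<le> 2 * (cmod (f x))\<^sup>2 + 2 * (cmod (int_op M k f x))\<^sup>2" .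
  qed (rule L)
  also have "\<dots> = 2 * (l2_norm M f)\<^sup>2 + 2 * (l2_norm M (int_op M k f))\<^sup>2"
    using f int_op_L2(1)[OF k f] by (simp add: L2_integrable_square l2_norm_square)
  also have "\<dots> \<le> (2 + 2 * (D * mass)\<^sup>2) * (l2_norm M f)\<^sup>2"
    using int_op_L2(2)[OF k f] by (simp add: distrib_right)
  also have "\<dots> = (sqrt (2 + 2 * (D * mass)\<^sup>2) * l2_norm M f)\<^sup>2"
    by (simp add: power_mult_distrib)
  finally show "l2_norm M (id_plus k f) \<le> sqrt (2 + 2 * (D * mass)\<^sup>2) * l2_norm M f"
    by (rule power2_le_imp_le) (simp add: l2_norm_nonneg)
qed

lemma id_plus_comp:
  assumes k: "dominated C k" and l: "dominated D l" and C: "0 \<le> C" and D: "0 \<le> D"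
    and f: "f \<in> L2 M" and x: "x \<in> space M"
  shows "id_plus k (id_plus l f) x = id_plus (\<lambda>x t. k x t + l x t + kernel_comp M k l x t) f x"
proof -
  have "int_op M k (id_plus l f) x = int_op M k f x + int_op M k (int_op M l f) x"
    using int_op_lincomb[OF k f int_op_L2(1)[OF l f] x, of 1 1] by (simp add: id_plus_def)
  then show ?thesis
    using int_op_add[OF dominated_add[OF k l] dominated_comp[OF k l C D] f x] int_op_add[OF k l f x]
      int_op_comp[OF k l C D f x]
    by (simp add: id_plus_def)
qed

lemma id_plus_adjoint:
  assumes k: "dominated D k" and D: "0 \<le> D"
  shows "l2_adjoint_of M (id_plus k) (id_plus (\<lambda>x t. k t x))"
  unfolding l2_adjoint_of_def
proof (intro conjI ballI)
  show "l2_bounded_op M (id_plus (\<lambda>x t. k t x))"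
    by (rule id_plus_bounded[OF dominated_transpose[OF k]])
  fix f g assume f: "f \<in> L2 M" and g: "g \<in> L2 M"
  have k': "int_op M (\<lambda>x t. k t x) g \<in> L2 M" by (rule int_op_L2[OF dominated_transpose[OF k] g])
  have "l2_inner M (id_plus k f) g = l2_inner M f g + l2_inner M (int_op M k f) g"
    using l2_inner_lincomb_left[OF f int_op_L2(1)[OF k f] g, of 1 1] by (simp add: id_plus_def)
  moreover have "l2_inner M (id_plus (\<lambda>x t. k t x) g) f
      = l2_inner M g f + l2_inner M (int_op M (\<lambda>x t. k t x) g) f"
    using l2_inner_lincomb_left[OF g k' f, of 1 1] by (simp add: id_plus_def)
  ultimately show "l2_inner M (id_plus k f) g = l2_inner M f (id_plus (\<lambda>x t. k t x) g)"
    by (simp add: int_op_adjoint[OF k D f g] l2_inner_commute[of M f])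
qed

lemma id_plus_cong:
  assumes "\<And>x t. x \<in> space M \<Longrightarrow> t \<in> space M \<Longrightarrow> k x t = l x t" "x \<in> space M"
    "\<And>t. t \<in> space M \<Longrightarrow> f t = g t"
  shows "id_plus k f x = id_plus l g x"
  using assms by (simp add: id_plus_def int_op_def cong: Bochner_Integration.integral_cong)

text \<open>The relation \<open>P\<close> records the support of the kernel, so that Volterra kernels have Volterra
  resolvents.\<close>

lemma right_resolvent_kernel:
  assumes v: "dominated D v" and D: "0 \<le> D" "D * mass < 1"
    and P: "transp P" "\<And>x t. x \<in> space M \<Longrightarrow> t \<in> space M \<Longrightarrow> \<not> P x t \<Longrightarrow> v x t = 0"
  obtains r where "dominated (D / (1 - D * mass)) r"
    "\<And>x t. x \<in> space M \<Longrightarrow> t \<in> space M \<Longrightarrow> v x t + r x t + kernel_comp M v r x t = 0"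
    "\<And>x t. x \<in> space M \<Longrightarrow> t \<in> space M \<Longrightarrow> \<not> P x t \<Longrightarrow> r x t = 0"
proof -
  \<comment> \<open>The sum of the Neumann series bound. The identity
    \<open>D + D * E * mass = E\<close> says that the ball of radius \<open>E\<close> is mapped into
    itself.\<close>
  define E where "E = D / (1 - D * mass)"
  have E: "0 \<le> E" "D + D * E * mass = E" using D by (simp_all add: E_def field_simps)
  \<comment> \<open>Bounds by this majorant carry the support condition through the
    iteration.\<close>
  define b where "b x t = (if P x t then w x * w t else 0)" for x t
  \<comment> \<open>A fixed point is a kernel r for which (I + V)(I + R) = I.\<close>
  define \<Phi> where "\<Phi> r = (\<lambda>x t. - v x t - kernel_comp M v r x t)" for r
  have supp: "r x t = 0" if "kernel_bounded M b C r" "x \<in> space M" "t \<in> space M" "\<not> P x t" for C r x t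
    using kernel_boundedD[OF that(1-3)] that(4) by (simp add: b_def)
  have dom: "dominated C r" if "kernel_bounded M b C r" "0 \<le> C" for C r
    unfolding kernel_bounded_def
  proof (intro conjI ballI)
    show "(\<lambda>(x, t). r x t) \<in> borel_measurable (M \<Otimes>\<^sub>M M)"
      using that(1) by (simp add: kernel_bounded_def)
    fix x t assume xt: "x \<in> space M" "t \<in> space M"
    have "b x t \<le> w x * w t" using w_nonneg xt by (simp add: b_def)
    from mult_left_mono[OF this that(2)] show "\<bar>r x t\<bar> \<le> C * (w x * w t)"
      using kernel_boundedD[OF that(1) xt] by linarith
  qed
  \<comment> \<open>If \<open>P x t\<close> fails, transitivity lets no \<open>s\<close> satisfy
    both \<open>P x s\<close> and \<open>P s t\<close>, so one factor of the integrand is always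
    0.\<close>
  have comp0: "kernel_comp M v r x t = 0"
    if r: "\<And>s. s \<in> space M \<Longrightarrow> \<not> P s t \<Longrightarrow> r s t = 0" and xt: "x \<in> space M" "t \<in> space M" "\<not> P x t" for r x t
  proof -
    have "kernel_comp M v r x t = (LINT s|M. 0)"
      unfolding kernel_comp_def
    proof (rule Bochner_Integration.integral_cong)
      fix s assume "s \<in> space M"
      then show "v x s * r s t = 0"
        using P(2)[of x s] r[of s] xt transpD[OF P(1), of x s t] by (cases "P x s") auto
    qed simp
    then show ?thesis by simp
  qed
  obtain r where r: "kernel_bounded M b E r"
    and fix_r: "\<And>x t. x \<in> space M \<Longrightarrow> t \<in> space M \<Longrightarrow> \<Phi> r x t = r x t"
  proof (rule kernel_fixed_point[of M b "D * mass" E \<Phi>])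
    show "0 \<le> b x t" if "x \<in> space M" "t \<in> space M" for x t
      using that by (simp add: b_def w_nonneg)
    show "0 \<le> D * mass" "D * mass < 1" "0 \<le> E" using D E mass_nonneg by auto
    show "kernel_bounded M b E (\<Phi> r)" if r: "kernel_bounded M b E r" for r
      unfolding kernel_bounded_def
    proof (intro conjI ballI)
      have [measurable]: "(\<lambda>(x, t). kernel_comp M v r x t) \<in> borel_measurable (M \<Otimes>\<^sub>M M)"
        by (rule kernel_comp_measurable[OF v r])
      have [measurable]: "(\<lambda>(x, t). v x t) \<in> borel_measurable (M \<Otimes>\<^sub>M M)"
        using v by (simp add: kernel_bounded_def)
      have "(\<lambda>p. - (case p of (x, t) \<Rightarrow> v x t) - (case p of (x, t) \<Rightarrow> kernel_comp M v r x t))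
          \<in> borel_measurable (M \<Otimes>\<^sub>M M)" by measurable
      then show "(\<lambda>(x, t). \<Phi> r x t) \<in> borel_measurable (M \<Otimes>\<^sub>M M)"
        by (simp add: \<Phi>_def case_prod_beta')
      fix x t assume xt: "x \<in> space M" "t \<in> space M"
      show "\<bar>\<Phi> r x t\<bar> \<le> E * b x t"
      proof (cases "P x t")
        case True
        have "\<bar>\<Phi> r x t\<bar> \<le> D * (w x * w t) + D * E * mass * (w x * w t)"
          using kernel_boundedD[OF v xt] kernel_comp_integrable(2)[OF v dom[OF r E(1)] D(1) E(1) xt]
          unfolding \<Phi>_def by linarith
        also have "\<dots> = E * (w x * w t)"
          unfolding distrib_right[symmetric] E(2) ..
        finally show ?thesis using True by (simp add: b_def)
      next
        case False
        then show ?thesis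
          using P(2)[OF xt] comp0[of t r x] supp[OF r] xt by (simp add: \<Phi>_def b_def)
      qed
    qed
    show "\<forall>x\<in>space M. \<forall>t\<in>space M. \<bar>\<Phi> r x t - \<Phi> r' x t\<bar> \<le> D * mass * d * b x t"
      if r: "kernel_bounded M b E r" "kernel_bounded M b E r'" and d: "0 \<le> d"
        and le: "\<forall>x\<in>space M. \<forall>t\<in>space M. \<bar>r x t - r' x t\<bar> \<le> d * b x t" for r r' d
    proof (intro ballI)
      fix x t assume xt: "x \<in> space M" "t \<in> space M"
      note [measurable] = kernel_bounded_measurable[OF r(1)] kernel_bounded_measurable[OF r(2)]
      have diff: "kernel_bounded M b d (\<lambda>x t. r x t - r' x t)"
        unfolding kernel_bounded_def
      proof (intro conjI)
        show "(\<lambda>(x, t). r x t - r' x t) \<in> borel_measurable (M \<Otimes>\<^sub>M M)" by measurable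
      qed (rule le)
      have "\<Phi> r x t - \<Phi> r' x t = - kernel_comp M v (\<lambda>x t. r x t - r' x t) x t"
        using kernel_comp_integrable(1)[OF v dom[OF r(1) E(1)] D(1) E(1) xt]
          kernel_comp_integrable(1)[OF v dom[OF r(2) E(1)] D(1) E(1) xt]
        by (simp add: \<Phi>_def kernel_comp_def right_diff_distrib)
      moreover have "\<bar>kernel_comp M v (\<lambda>x t. r x t - r' x t) x t\<bar> \<le> D * d * mass * b x t"
      proof (cases "P x t")
        case True
        then show ?thesis
          using kernel_comp_integrable(2)[OF v dom[OF diff d] D(1) d xt] by (simp add: b_def)
      next
        case False
        then show ?thesis
          using comp0[of t "\<lambda>x t. r x t - r' x t" x] supp[OF diff] xt by (simp add: b_def)
      qed
      ultimately show "\<bar>\<Phi> r x t - \<Phi> r' x t\<bar> \<le> D * mass * d * b x t"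
        by (simp add: ac_simps)
    qed
  qed (rule that)
  show ?thesis
  proof (rule that)
    show "dominated (D / (1 - D * mass)) r"
      using dom[OF r E(1)] by (simp add: E_def)
    show "v x t + r x t + kernel_comp M v r x t = 0" if "x \<in> space M" "t \<in> space M" for x t
      using fix_r[OF that] by (simp add: \<Phi>_def)
    show "r x t = 0" if "x \<in> space M" "t \<in> space M" "\<not> P x t" for x t
      by (rule supp[OF r that])
  qed
qed

text \<open>A right inverse \<open>R\<close> of \<open>I + V\<close> that has a right inverse itself is also a left inverse.\<close>

lemma id_plus_inverse:
  assumes v: "dominated D v" and D: "0 \<le> D" "2 * (D * mass) < 1"
    and P: "transp P" "\<And>x t. x \<in> space M \<Longrightarrow> t \<in> space M \<Longrightarrow> \<not> P x t \<Longrightarrow> v x t = 0"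
  obtains r E where "0 \<le> E" "dominated E r" "l2_inverse_of M (id_plus v) (id_plus r)"
    "\<And>x t. x \<in> space M \<Longrightarrow> t \<in> space M \<Longrightarrow> \<not> P x t \<Longrightarrow> r x t = 0"
proof -
  define E where "E = D / (1 - D * mass)"
  have "0 \<le> D * mass" using D mass_nonneg by simp
  with D(2) have D': "D * mass < 1" by linarith
  \<comment> \<open>Since E mass = D mass / (1 - D mass), the factor 2 in the assumption is what
    makes the resolvent kernel small enough to have a resolvent itself.\<close>
  have E: "0 \<le> E" "E * mass < 1" using D D' by (simp_all add: E_def field_simps)
  have right: "id_plus k (id_plus l f) x = f x"
    if "dominated A k" "dominated B l" "0 \<le> A" "0 \<le> B"
      "\<forall>x\<in>space M. \<forall>t\<in>space M. k x t + l x t + kernel_comp M k l x t = 0"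
      "f \<in> L2 M" "x \<in> space M" for A B k l f x
  proof -
    have "id_plus k (id_plus l f) x = id_plus (\<lambda>_ _. 0) f x"
      unfolding id_plus_comp[OF that(1-4,6,7)] by (rule id_plus_cong) (use that in auto)
    then show ?thesis by (simp add: id_plus_def int_op_def)
  qed
  obtain r where r: "dominated E r"
    "\<And>x t. x \<in> space M \<Longrightarrow> t \<in> space M \<Longrightarrow> v x t + r x t + kernel_comp M v r x t = 0"
    "\<And>x t. x \<in> space M \<Longrightarrow> t \<in> space M \<Longrightarrow> \<not> P x t \<Longrightarrow> r x t = 0"
    by (rule right_resolvent_kernel[OF v D(1) D' P(1), folded E_def], erule (2) P(2)) (rule that)
  obtain r' where r': "dominated (E / (1 - E * mass)) r'"
    "\<And>x t. x \<in> space M \<Longrightarrow> t \<in> space M \<Longrightarrow> r x t + r' x t + kernel_comp M r r' x t = 0"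
    "\<And>x t. x \<in> space M \<Longrightarrow> t \<in> space M \<Longrightarrow> \<not> P x t \<Longrightarrow> r' x t = 0"
    by (rule right_resolvent_kernel[OF r(1) E P(1)], erule (2) r(3)) (rule that)
  have E': "0 \<le> E / (1 - E * mass)" using E by simp
  have VR: "id_plus v (id_plus r f) x = f x" if "f \<in> L2 M" "x \<in> space M" for f x
    using right[OF v r(1) D(1) E(1) _ that] r(2) by blast
  have RR': "id_plus r (id_plus r' f) x = f x" if "f \<in> L2 M" "x \<in> space M" for f x
    using right[OF r(1) r'(1) E(1) E' _ that] r'(2) by blast
  \<comment> \<open>From \<open>VR\<close> and \<open>RR'\<close>, I + V agrees with (I + V)(I +
    R)(I + R'), that is with I + R'. Hence (I + R)(I + V) = (I + R)(I + R') = I.\<close>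
  have RV: "id_plus r (id_plus v f) x = f x" if f: "f \<in> L2 M" and x: "x \<in> space M" for f x
  proof -
    have R'f: "id_plus r' f \<in> L2 M"
      using id_plus_bounded[OF r'(1)] f by (simp add: l2_bounded_op_def)
    have "id_plus v f t = id_plus r' f t" if t: "t \<in> space M" for t
    proof -
      have "id_plus v f t = id_plus v (id_plus r (id_plus r' f)) t"
        by (rule id_plus_cong[OF refl t]) (simp add: RR'[OF f])
      also have "\<dots> = id_plus r' f t" by (rule VR[OF R'f t])
      finally show ?thesis .
    qed
    then have "id_plus r (id_plus v f) x = id_plus r (id_plus r' f) x"
      by (intro id_plus_cong[OF refl x])
    then show ?thesis using RR'[OF f x] by simp
  qed
  have "l2_inverse_of M (id_plus v) (id_plus r)"
    unfolding l2_inverse_of_def l2_op_eq_def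
    using id_plus_bounded[OF r(1)] VR RV by auto
  then show ?thesis using that E(1) r(1,3) by blast
qed

text \<open>With A self-adjoint, the inner product of Ke and e is the squared norm of Ae, so the
  trace sums are Hilbert-Schmidt sums of A. As K is positive and self-adjoint, it is entered in the
  definition both as its own adjoint and as its own absolute value.\<close>

lemma int_op_square_trace_class:
  assumes a: "dominated D a" and D: "0 \<le> D" and sym: "\<And>x t. a x t = a t x"
    and K: "l2_bounded_op M K" "l2_op_eq M K (int_op M a \<circ> int_op M a)"
  shows "l2_trace_class M K"
proof -
  let ?A = "int_op M a"
  have A: "l2_bounded_op M ?A" by (rule int_op_bounded[OF a])
  have "(\<lambda>x t. a t x) = a" using sym by (simp add: fun_eq_iff)
  then have self: "l2_inner M (?A f) g = l2_inner M f (?A g)" if "f \<in> L2 M" "g \<in> L2 M" for f g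
    using int_op_adjoint[OF a D that] by simp
  then have adj: "l2_adjoint_of M ?A ?A"
    using A by (simp add: l2_adjoint_of_def)
  note form = l2_positive_factor(1)[OF K(1) A adj K(2)]
  have pos: "l2_positive M K" by (rule l2_positive_factor(2)[OF K(1) A adj K(2)])
  \<comment> \<open>\<open>K\<close> and the square of \<open>?A\<close> agree only almost
    everywhere, hence the detour through the integral.\<close>
  have inner: "l2_inner M (K f) g = l2_inner M (?A f) (?A g)" if f: "f \<in> L2 M" and g: "g \<in> L2 M" for f g
  proof -
    have Af: "?A f \<in> L2 M" by (rule int_op_L2[OF a f])
    have AAf: "?A (?A f) \<in> L2 M" by (rule int_op_L2[OF a Af])
    have Kf: "K f \<in> L2 M" using K(1) f by (simp add: l2_bounded_op_def)
    have "l2_inner M (K f) g = l2_inner M (?A (?A f)) g"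
      unfolding l2_inner_def
    proof (rule Bochner_Integration.integral_cong_AE)
      show "AE x in M. K f x * cnj (g x) = ?A (?A f) x * cnj (g x)"
        using K(2) f by (auto simp: l2_op_eq_def)
    qed (use L2_integrable_inner[OF Kf g] L2_integrable_inner[OF AAf g] in
        \<open>auto dest: borel_measurable_integrable\<close>)
    then show ?thesis using self[OF Af g] by simp
  qed
  have adjK: "l2_adjoint_of M K K"
    unfolding l2_adjoint_of_def
  proof (intro conjI ballI)
    fix f g assume f: "f \<in> L2 M" and g: "g \<in> L2 M"
    have "l2_inner M f (K g) = cnj (l2_inner M (K g) f)" by (rule l2_inner_commute)
    also have "\<dots> = l2_inner M (?A f) (?A g)"
      unfolding inner[OF g f] by (rule l2_inner_commute[symmetric])
    finally show "l2_inner M (K f) g = l2_inner M f (K g)" using inner[OF f g] by simp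
  qed (rule K(1))
  obtain B where B: "l2_onb M B" using l2_onb_exists by blast
  have "(\<lambda>e. Re (l2_inner M (K e) e)) summable_on B"
  proof (rule nonneg_bdd_above_summable_on)
    show "0 \<le> Re (l2_inner M (K e) e)" if "e \<in> B" for e
      using pos that B by (auto simp: l2_positive_def l2_onb_def)
    show "bdd_above (sum (\<lambda>e. Re (l2_inner M (K e) e)) ` {F. F \<subseteq> B \<and> finite F})"
    proof (rule bdd_aboveI2)
      fix F assume F: "F \<in> {F. F \<subseteq> B \<and> finite F}"
      then have FL: "F \<subseteq> L2 M" using B by (auto simp: l2_onb_def)
      have orth: "l2_inner M e e' = (if e = e' then 1 else 0)" if "e \<in> F" "e' \<in> F" for e e'
        using B F that unfolding l2_onb_def by blast
      have "(\<Sum>e\<in>F. Re (l2_inner M (K e) e)) = (\<Sum>e\<in>F. (l2_norm M (?A e))\<^sup>2)"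
        by (intro sum.cong refl) (use form FL in \<open>auto simp del: of_real_power\<close>)
      also have "\<dots> \<le> (D * mass)\<^sup>2"
        using F by (intro int_op_hilbert_schmidt[OF a D _ FL orth]) auto
      finally show "(\<Sum>e\<in>F. Re (l2_inner M (K e) e)) \<le> (D * mass)\<^sup>2" .
    qed
  qed
  then show ?thesis
    unfolding l2_trace_class_def using K(1) adjK pos B
    by (intro conjI exI[of _ K] exI[of _ B]) (auto simp: l2_op_eq_def)
qed

end

section \<open>Integration over half lines\<close>

lemma space_half_line [simp]: "space (half_line a) = {a<..}"
  by (simp add: half_line_def space_restrict_space)

lemma borel_measurable_half_line:
  "f \<in> borel_measurable borel \<Longrightarrow> f \<in> borel_measurable (half_line a)"
  unfolding half_line_def by (intro measurable_restrict_space1) simp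

text \<open>The end point is a null set. The closed half line is the form in which limits at
  infinity and Gaussian moments are used below.\<close>

lemma integrable_half_line_iff:
  fixes f :: "real \<Rightarrow> 'a::{banach, second_countable_topology}"
  shows "integrable (half_line a) f \<longleftrightarrow> set_integrable lborel {a..} f"
proof -
  have "integrable (half_line a) f \<longleftrightarrow> set_integrable lborel {a<..} f"
    by (simp add: half_line_def integrable_restrict_space set_integrable_def)
  also have "\<dots> \<longleftrightarrow> set_integrable lborel {a..} f"
    by (rule set_integrable_discrete_difference[where X = "{a}"]) auto
  finally show ?thesis .
qed

lemma integral_half_line:
  fixes f :: "real \<Rightarrow> 'a::{banach, second_countable_topology}"
  shows "(LINT x|half_line a. f x) = (LINT x:{a..}|lborel. f x)"
proof -
  have "(LINT x|half_line a. f x) = (LINT x:{a<..}|lborel. f x)"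
    by (simp add: half_line_def integral_restrict_space set_lebesgue_integral_def)
  also have "\<dots> = (LINT x:{a..}|lborel. f x)"
    by (rule set_integral_discrete_difference[where X = "{a}"]) auto
  finally show ?thesis .
qed

text \<open>Phrased as a limit so that it works in both directions: where the limit of
  \<open>F\<close> is known it evaluates the integral, and for the shifted contour it proves that
  the limit exists.\<close>

lemma half_line_FTC:
  fixes F f :: "real \<Rightarrow> 'a::euclidean_space"
  assumes F: "\<And>x. (F has_vector_derivative f x) (at x)"
    and f: "continuous_on UNIV f" "integrable (half_line a) f"
  shows "(F \<longlongrightarrow> F a + (LINT x|half_line a. f x)) at_top"
proof -
  have "((\<lambda>b. F a + (LINT x:{a..b}|lborel. f x)) \<longlongrightarrow> F a + (LINT x|half_line a. f x)) at_top"
    unfolding integral_half_line using f(2)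
    by (intro tendsto_intros tendsto_set_lebesgue_integral_at_top)
      (auto simp: integrable_half_line_iff)
  moreover have "\<forall>\<^sub>F b in at_top. F a + (LINT x:{a..b}|lborel. f x) = F b"
    using eventually_ge_at_top[of a]
  proof eventually_elim
    case (elim b)
    have "(LINT x:{a..b}|lborel. f x) = F b - F a"
      unfolding set_lebesgue_integral_def
      using elim F continuous_on_subset[OF f(1)]
      by (intro integral_FTC_atLeastAtMost) (auto intro: has_vector_derivative_at_within)
    then show ?case by simp
  qed
  ultimately show ?thesis by (rule Lim_transform_eventually)
qed

text \<open>This is the integral of the squared weight, and also the majorant for products Ai(x+s)
  Ai(t+s).\<close>

lemma half_line_exp:
  shows "integrable (half_line a) (\<lambda>s. exp (- 2 * s))"
    and "(LINT s|half_line a. exp (- 2 * s)) = exp (- 2 * a) / 2"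
proof -
  define F :: "real \<Rightarrow> real" where "F = (\<lambda>s. - exp (- 2 * s) / 2)"
  have F: "DERIV F s :> exp (- 2 * s)" for s
    unfolding F_def by (auto intro!: derivative_eq_intros)
  have lim: "(F \<longlongrightarrow> 0) at_top"
    unfolding F_def by real_asymp
  have "(\<integral>\<^sup>+s. ennreal (exp (- 2 * s)) * indicator {a..} s \<partial>lborel) = ennreal (0 - F a)"
    by (rule nn_integral_FTC_atLeast[OF _ F _ lim]) auto
  also have "(\<integral>\<^sup>+s. ennreal (exp (- 2 * s)) * indicator {a..} s \<partial>lborel)
      = (\<integral>\<^sup>+s. ennreal (indicator {a..} s *\<^sub>R exp (- 2 * s)) \<partial>lborel)"
    by (intro nn_integral_cong) (auto split: split_indicator)
  finally show int: "integrable (half_line a) (\<lambda>s. exp (- 2 * s))"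
    unfolding integrable_half_line_iff set_integrable_def
    by (intro integrableI_nonneg) auto
  have "(F \<longlongrightarrow> F a + (LINT s|half_line a. exp (- 2 * s))) at_top"
    by (intro half_line_FTC int F[unfolded has_real_derivative_iff_has_vector_derivative] continuous_intros)
  with lim have "0 = F a + (LINT s|half_line a. exp (- 2 * s))"
    by (intro tendsto_unique[of at_top F]) auto
  then show "(LINT s|half_line a. exp (- 2 * s)) = exp (- 2 * a) / 2"
    by (simp add: F_def)
qed

text \<open>Majorants for the moment integrands, since 1 + t^2 bounds the modulus of t + i. The
  binomial theorem reduces them to even Gaussian moments.\<close>

lemma half_line_gaussian:
  "integrable (half_line 0) (\<lambda>t. (1 + t\<^sup>2) ^ n * exp (- t\<^sup>2))"
proof -
  have *: "integrable (half_line 0) (\<lambda>t. exp (- t\<^sup>2) * t ^ (2 * k))" for k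
    using gaussian_moment_even_pos[of k]
    by (auto simp: integrable_half_line_iff set_integrable_def intro: integrable.intros)
  have "(1 + t\<^sup>2) ^ n * exp (- t\<^sup>2) = (\<Sum>k\<le>n. real (n choose k) * (exp (- t\<^sup>2) * t ^ (2 * k)))" for t :: real
    unfolding add.commute[of 1] binomial_ring
    by (simp add: sum_distrib_right sum_distrib_left ac_simps flip: power_mult)
  then show ?thesis using * by simp
qed

section \<open>The Airy function\<close>

text \<open>An entire function of \<open>z\<close> whose real part on the real axis is the cosine in
  the definition of \<open>airy\<close>.\<close>

definition airy_phase :: "real \<Rightarrow> complex \<Rightarrow> complex" where
  "airy_phase x z = exp (\<i> * (z ^ 3 / 3 + of_real x * z))"

text \<open>As Im (t + i \<eta>)^3 = 3 t^2 \<eta> - \<eta>^3, raising the contour produces a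
  Gaussian in t. The height \<eta> = 1 produces the decay exp(-x), which becomes the weight.\<close>

lemma norm_airy_phase:
  "norm (airy_phase x (of_real t + \<i> * of_real \<eta>)) = exp (\<eta> ^ 3 / 3 - x * \<eta> - \<eta> * t\<^sup>2)"
  by (simp add: airy_phase_def power3_eq_cube power2_eq_square field_simps)

lemma norm_airy_phase_line: "norm (airy_phase x (of_real t + \<i>)) = exp (1 / 3 - x) * exp (- t\<^sup>2)"
  using norm_airy_phase[of x t 1] by (simp flip: exp_add)

lemma airy_phase_has_derivative [derivative_intros]:
  assumes "(g has_vector_derivative g') (at t within S)"
  shows "((\<lambda>t. airy_phase x (g t)) has_vector_derivative
    (g' * (\<i> * ((g t)\<^sup>2 + of_real x) * airy_phase x (g t)))) (at t within S)"
proof -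
  have "(airy_phase x has_field_derivative \<i> * (z\<^sup>2 + of_real x) * airy_phase x z) (at z within T)" for z T
    unfolding airy_phase_def by (auto intro!: derivative_eq_intros simp: field_simps)
  from field_vector_diff_chain_within[OF assms this] show ?thesis by (simp add: o_def)
qed

lemma continuous_airy_phase [continuous_intros]:
  assumes "continuous_on S g"
  shows "continuous_on S (\<lambda>t. airy_phase x (g t))"
  unfolding airy_phase_def using assms by (intro continuous_intros) auto

text \<open>Each differentiation of the phase in \<open>x\<close> brings down a factor i z, so this
  is the n-th derivative in \<open>x\<close> of the integral over the shifted contour.\<close>

definition airy_moment :: "nat \<Rightarrow> real \<Rightarrow> complex" where
  "airy_moment n x = (LINT t|half_line 0. (\<i> * (of_real t + \<i>)) ^ n * airy_phase x (of_real t + \<i>))"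

lemma norm_line_le: "norm (complex_of_real t + \<i>) \<le> 1 + t\<^sup>2"
proof -
  have "norm (complex_of_real t + \<i>) = sqrt (1 + t\<^sup>2)" by (simp add: cmod_def add.commute)
  also have "\<dots> \<le> 1 + t\<^sup>2"
    by (rule real_le_lsqrt) (simp_all add: power2_eq_square distrib_left distrib_right)
  finally show ?thesis .
qed

lemma airy_moment_integrand_bound:
  "norm ((\<i> * (of_real t + \<i>)) ^ n * airy_phase x (of_real t + \<i>))
     \<le> exp (1 / 3 - x) * ((1 + t\<^sup>2) ^ n * exp (- t\<^sup>2))"
  using power_mono[OF norm_line_le[of t] norm_ge_zero, of n]
  by (simp add: norm_mult norm_power norm_airy_phase_line mult_right_mono)

lemma airy_moment_integrable:
  "integrable (half_line 0) (\<lambda>t. (\<i> * (of_real t + \<i>)) ^ n * airy_phase x (of_real t + \<i>))"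
  by (rule integrable_dominated[OF integrable_mult_right[OF half_line_gaussian] _ airy_moment_integrand_bound])
     (intro borel_measurable_half_line borel_measurable_continuous_onI continuous_intros)

lemma norm_airy_moment:
  "norm (airy_moment n x) \<le> (LINT t|half_line 0. (1 + t\<^sup>2) ^ n * exp (- t\<^sup>2)) * exp (1 / 3 - x)"
proof -
  have "norm (airy_moment n x) \<le> (LINT t|half_line 0. exp (1 / 3 - x) * ((1 + t\<^sup>2) ^ n * exp (- t\<^sup>2)))"
    unfolding airy_moment_def
    by (intro norm_integral_le airy_moment_integrable integrable_mult_right half_line_gaussian
        airy_moment_integrand_bound)
  then show ?thesis by (simp add: mult.commute)
qed

lemma airy_phase_shift: "airy_phase (x + h) z = airy_phase x z * exp (\<i> * of_real h * z)"
  by (simp add: airy_phase_def algebra_simps flip: exp_add)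

text \<open>Differentiation under the integral sign, by the second order Taylor bound for exp at u =
  i h z. On the line Im z = 1 the real part of u is -h, so exp |Re u| is uniform in t, and the
  factor |z|^2 in the remainder raises the moment index by 2.\<close>

lemma airy_moment_taylor:
  obtains C where "\<And>h. norm (airy_moment n (x + h) - airy_moment n x - of_real h * airy_moment (Suc n) x)
    \<le> C * exp \<bar>h\<bar> * h\<^sup>2"
proof
  fix h
  define z where "z t = complex_of_real t + \<i>" for t
  define A where "A n y t = (\<i> * z t) ^ n * airy_phase y (z t)" for n y t
  define B where "B t = exp (1 / 3 - x) * ((1 + t\<^sup>2) ^ (n + 2) * exp (- t\<^sup>2))" for t
  have A: "integrable (half_line 0) (A n y)" for n y
    unfolding A_def z_def by (rule airy_moment_integrable)
  have moment: "airy_moment n y = (LINT t|half_line 0. A n y t)" for n y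
    by (simp only: airy_moment_def A_def z_def)
  have B: "integrable (half_line 0) B"
    unfolding B_def by (intro integrable_mult_right half_line_gaussian)
  have le: "norm (A n (x + h) t - A n x t - of_real h * A (Suc n) x t) \<le> exp \<bar>h\<bar> * h\<^sup>2 * B t" for t
  proof -
    define u where "u = \<i> * of_real h * z t"
    have "norm (exp u - (\<Sum>k\<le>1. u ^ k / fact k)) \<le> exp \<bar>Re u\<bar> * norm u ^ Suc 1 / fact 1"
      by (rule Taylor_exp)
    then have taylor: "norm (exp u - 1 - u) \<le> exp \<bar>h\<bar> * (h\<^sup>2 * (norm (z t))\<^sup>2)"
      by (simp add: u_def z_def norm_mult power_mult_distrib diff_diff_eq power2_eq_square[symmetric])
    have "A n (x + h) t - A n x t - of_real h * A (Suc n) x t = A n x t * (exp u - 1 - u)"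
      unfolding A_def airy_phase_shift u_def by (simp add: algebra_simps)
    then have "norm (A n (x + h) t - A n x t - of_real h * A (Suc n) x t)
        \<le> norm (A n x t) * (exp \<bar>h\<bar> * (h\<^sup>2 * (norm (z t))\<^sup>2))"
      using taylor by (simp add: norm_mult mult_left_mono)
    also have "\<dots> = exp \<bar>h\<bar> * h\<^sup>2 * norm (A (n + 2) x t)"
      by (simp add: A_def norm_mult norm_power power2_eq_square)
    also have "\<dots> \<le> exp \<bar>h\<bar> * h\<^sup>2 * B t"
      unfolding A_def B_def z_def by (intro mult_left_mono airy_moment_integrand_bound) simp
    finally show ?thesis .
  qed
  have "airy_moment n (x + h) - airy_moment n x - of_real h * airy_moment (Suc n) x
      = (LINT t|half_line 0. A n (x + h) t - A n x t - of_real h * A (Suc n) x t)"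
    using A by (simp add: moment)
  also have "norm \<dots> \<le> (LINT t|half_line 0. exp \<bar>h\<bar> * h\<^sup>2 * B t)"
    using A B by (intro norm_integral_le le) auto
  finally show "norm (airy_moment n (x + h) - airy_moment n x - of_real h * airy_moment (Suc n) x)
      \<le> (LINT t|half_line 0. B t) * exp \<bar>h\<bar> * h\<^sup>2"
    by (simp add: ac_simps)
qed

definition airy_deriv :: "nat \<Rightarrow> real \<Rightarrow> real" where
  "airy_deriv n x = Re (airy_moment n x) / pi"

lemma DERIV_airy_deriv: "DERIV (airy_deriv n) x :> airy_deriv (Suc n) x"
proof -
  obtain C where C: "\<And>h. norm (airy_moment n (x + h) - airy_moment n x - of_real h * airy_moment (Suc n) x)
    \<le> C * exp \<bar>h\<bar> * h\<^sup>2"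
    using airy_moment_taylor by blast
  have le: "norm ((airy_deriv n (x + h) - airy_deriv n x) / h - airy_deriv (Suc n) x)
      \<le> C * exp \<bar>h\<bar> * \<bar>h\<bar> / pi" if "h \<noteq> 0" for h
  proof -
    have "(airy_deriv n (x + h) - airy_deriv n x) / h - airy_deriv (Suc n) x
        = Re (airy_moment n (x + h) - airy_moment n x - of_real h * airy_moment (Suc n) x) / (h * pi)"
      using that by (simp add: airy_deriv_def field_simps)
    also have "norm \<dots> \<le> norm (airy_moment n (x + h) - airy_moment n x - of_real h * airy_moment (Suc n) x)
        / (\<bar>h\<bar> * pi)"
      unfolding real_norm_def abs_divide abs_mult
      by (intro divide_mono abs_Re_le_cmod) (use that in auto)
    also have "\<dots> \<le> C * exp \<bar>h\<bar> * h\<^sup>2 / (\<bar>h\<bar> * pi)"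
      by (intro divide_right_mono C) simp
    also have "\<dots> = C * exp \<bar>h\<bar> * \<bar>h\<bar> / pi"
      using that by (simp add: field_simps power2_eq_square)
    finally show ?thesis .
  qed
  have "((\<lambda>h. C * exp \<bar>h\<bar> * \<bar>h\<bar> / pi) \<longlongrightarrow> C * exp \<bar>0\<bar> * \<bar>0\<bar> / pi) (at 0)"
    by (intro tendsto_intros) auto
  then have lim: "((\<lambda>h. C * exp \<bar>h\<bar> * \<bar>h\<bar> / pi) \<longlongrightarrow> 0) (at 0)" by simp
  have "\<forall>\<^sub>F h in at 0. norm ((airy_deriv n (x + h) - airy_deriv n x) / h - airy_deriv (Suc n) x)
      \<le> C * exp \<bar>h\<bar> * \<bar>h\<bar> / pi"
    unfolding eventually_at_filter using le by (intro always_eventually allI impI)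
  from Lim_null_comparison[OF this lim]
  have "((\<lambda>h. (airy_deriv n (x + h) - airy_deriv n x) / h - airy_deriv (Suc n) x) \<longlongrightarrow> 0) (at 0)" .
  then show ?thesis
    unfolding DERIV_def by (rule LIM_zero_cancel)
qed

section \<open>The Airy equation and the identification with the defining integral\<close>

lemma airy_phase_line_tendsto_0: "((\<lambda>t. airy_phase x (of_real t + \<i>)) \<longlongrightarrow> 0) at_top"
proof (rule Lim_null_comparison)
  show "((\<lambda>t. exp (1 / 3 - x) * exp (- t\<^sup>2)) \<longlongrightarrow> 0) at_top" by real_asymp
qed (simp add: norm_airy_phase_line)

text \<open>Real values on the imaginary axis make the boundary term at i in the Airy equation real,
  and make the integrand along the vertical segment, with dz = i d\<eta>, purely imaginary.\<close>

lemma airy_phase_imaginary: "airy_phase x (\<i> * of_real \<eta>) = of_real (exp (\<eta> ^ 3 / 3 - x * \<eta>))"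
  unfolding airy_phase_def exp_of_real[symmetric]
  by (rule arg_cong[of _ _ exp]) (simp add: power3_eq_cube algebra_simps)

text \<open>The derivative of the phase along the contour is i (z^2 + x) times the phase, that is i
  (x A_0 - A_2) in terms of the moment integrands. Its integral is minus the real boundary value at
  i, so taking imaginary parts leaves the Airy equation.\<close>

lemma airy_deriv_2: "airy_deriv 2 x = x * airy_deriv 0 x"
proof -
  define A where "A n t = (\<i> * (complex_of_real t + \<i>)) ^ n * airy_phase x (of_real t + \<i>)" for n t
  define F where "F t = airy_phase x (of_real t + \<i>)" for t
  define f where "f t = \<i> * ((complex_of_real t + \<i>)\<^sup>2 + of_real x) * airy_phase x (of_real t + \<i>)" for t
  have f: "f t = \<i> * (of_real x * A 0 t - A 2 t)" for t
    unfolding f_def A_def power_mult_distrib by (simp add: algebra_simps)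
  have A: "integrable (half_line 0) (A n)" for n
    unfolding A_def by (rule airy_moment_integrable)
  have moment: "airy_moment n x = (LINT t|half_line 0. A n t)" for n
    by (simp only: airy_moment_def A_def)
  have "(F \<longlongrightarrow> F 0 + (LINT t|half_line 0. f t)) at_top"
  proof (rule half_line_FTC)
    show "(F has_vector_derivative f t) (at t)" for t
      unfolding F_def f_def by (auto intro!: derivative_eq_intros)
    show "continuous_on UNIV f"
      unfolding f_def by (intro continuous_intros)
    show "integrable (half_line 0) f" unfolding f using A by simp
  qed
  then have "F 0 + (LINT t|half_line 0. f t) = 0"
    using airy_phase_line_tendsto_0[of x, folded F_def] by (rule tendsto_unique[rotated]) simp
  moreover have "(LINT t|half_line 0. f t) = \<i> * (of_real x * airy_moment 0 x - airy_moment 2 x)"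
    unfolding f moment using A by simp
  moreover have "Im (F 0) = 0"
    using airy_phase_imaginary[of x 1] by (simp add: F_def)
  ultimately have "Re (of_real x * airy_moment 0 x - airy_moment 2 x) = 0"
    by (metis Im_i_times add_cancel_right_left plus_complex.sel(2) zero_complex.sel(2))
  then show ?thesis by (simp add: airy_deriv_def)
qed

text \<open>The contour of integration is moved from the positive real axis to the half line
  \<open>Im z = 1\<close>, \<open>Re z > 0\<close>, where the integrand decays like a Gaussian. The piece of the imaginary
  axis between the two contours contributes nothing to the real part.\<close>

lemma airy_eq: "airy x = airy_deriv 0 x"
proof -
  have "airy_phase x holomorphic_on UNIV"
    unfolding airy_phase_def by (intro holomorphic_intros) auto
  \<comment> \<open>With an entire primitive, every contour integral becomes a difference of values
    of \<open>P\<close>, and Cauchy's theorem is built in.\<close>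
  then obtain P where P: "\<And>z. (P has_field_derivative airy_phase x z) (at z)"
    using holomorphic_convex_primitive'[of UNIV "airy_phase x"] by auto
  have Pv: "((\<lambda>t. P (g t)) has_vector_derivative g' * airy_phase x (g t)) (at t within S)"
    if "(g has_vector_derivative g') (at t within S)" for g g' t S
    using field_vector_diff_chain_within[OF that has_field_derivative_at_within[OF P]] by (simp add: o_def)
  have real_axis: "integral {0..R} (\<lambda>t. cos (t ^ 3 / 3 + x * t)) = Re (P (of_real R)) - Re (P 0)"
    if "0 \<le> R" for R
  proof (rule integral_unique)
    have "((\<lambda>t. Re (P (of_real t))) has_real_derivative cos (t ^ 3 / 3 + x * t)) (at t within {0..R})" for t
    proof -
      have "((\<lambda>t. P (of_real t)) has_vector_derivative 1 * airy_phase x (of_real t)) (at t within {0..R})"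
        by (intro Pv) (auto intro!: derivative_eq_intros)
      then have "((\<lambda>t. Re (P (of_real t))) has_vector_derivative Re (1 * airy_phase x (of_real t)))
          (at t within {0..R})"
        by (rule bounded_linear.has_vector_derivative[OF bounded_linear_Re])
      moreover have "airy_phase x (of_real t) = exp (\<i> * of_real (t ^ 3 / 3 + x * t))"
        by (simp add: airy_phase_def)
      ultimately show ?thesis
        by (simp add: has_real_derivative_iff_has_vector_derivative Re_exp)
    qed
    then show "((\<lambda>t. cos (t ^ 3 / 3 + x * t)) has_integral Re (P (of_real R)) - Re (P 0)) {0..R}"
      using fundamental_theorem_of_calculus[OF that, of "\<lambda>t. Re (P (of_real t))" "\<lambda>t. cos (t ^ 3 / 3 + x * t)"]
      by (simp add: has_real_derivative_iff_has_vector_derivative)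
  qed
  have "((\<lambda>t. P (of_real t + \<i>)) \<longlongrightarrow> P (of_real 0 + \<i>)
      + (LINT t|half_line 0. airy_phase x (of_real t + \<i>))) at_top"
  proof (rule half_line_FTC)
    show "((\<lambda>t. P (of_real t + \<i>)) has_vector_derivative airy_phase x (of_real t + \<i>)) (at t)" for t
    proof -
      have "((\<lambda>t. complex_of_real t + \<i>) has_vector_derivative 1) (at t)"
        by (auto intro!: derivative_eq_intros)
      from Pv[OF this] show ?thesis by simp
    qed
    show "continuous_on UNIV (\<lambda>t. airy_phase x (of_real t + \<i>))"
      by (intro continuous_intros)
    show "integrable (half_line 0) (\<lambda>t. airy_phase x (of_real t + \<i>))"
      using airy_moment_integrable[of 0 x] by simp
  qed
  then have shifted: "((\<lambda>t. P (of_real t + \<i>)) \<longlongrightarrow> P \<i> + airy_moment 0 x) at_top"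
    by (simp add: airy_moment_def)
  \<comment> \<open>Along the imaginary axis the derivative of \<open>P\<close> is i times a real
    number, so its real part is constant.\<close>
  have "\<exists>c. \<forall>\<eta>. Re (P (\<i> * of_real \<eta>)) = c"
  proof (intro exI allI)
    fix \<eta>
    have "DERIV (\<lambda>\<eta>. Re (P (\<i> * of_real \<eta>))) \<eta> :> 0" for \<eta>
    proof -
      have "((\<lambda>\<eta>. P (\<i> * of_real \<eta>)) has_vector_derivative \<i> * airy_phase x (\<i> * of_real \<eta>)) (at \<eta>)"
        by (intro Pv) (auto intro!: derivative_eq_intros)
      then have "((\<lambda>\<eta>. Re (P (\<i> * of_real \<eta>))) has_vector_derivative
          Re (\<i> * airy_phase x (\<i> * of_real \<eta>))) (at \<eta>)"
        by (rule bounded_linear.has_vector_derivative[OF bounded_linear_Re])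
      then show ?thesis
        by (simp add: has_real_derivative_iff_has_vector_derivative airy_phase_imaginary)
    qed
    then show "Re (P (\<i> * of_real \<eta>)) = Re (P (\<i> * of_real 0))"
      using DERIV_isconst_all by blast
  qed
  then have corner: "Re (P \<i>) = Re (P 0)"
    by (metis mult.right_neutral mult_zero_right of_real_0 of_real_1)
  \<comment> \<open>The side at Re z = R closes the contour. There the phase is at most exp(1/3 +
    |x|) exp(-R^2 \<eta>), whose integral over \<eta> is of order R^(-2); \<open>\<phi>\<close> is a
    primitive of this bound, used in the mean value inequality.\<close>
  have vertical: "norm (P (of_real R + \<i>) - P (of_real R)) \<le> exp (1 / 3 + \<bar>x\<bar>) / R\<^sup>2" if "0 < R" for R
  proof -
    define \<phi> where "\<phi> \<eta> = - exp (1 / 3 + \<bar>x\<bar>) * exp (- (R\<^sup>2) * \<eta>) / R\<^sup>2" for \<eta>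
    have dP: "((\<lambda>\<eta>. P (of_real R + \<i> * of_real \<eta>)) has_vector_derivative
        \<i> * airy_phase x (of_real R + \<i> * of_real \<eta>)) (at \<eta>)" for \<eta>
      by (intro Pv) (auto intro!: derivative_eq_intros)
    have "DERIV (\<lambda>\<eta>. - c * exp (- r * \<eta>) / r) \<eta> :> c * exp (- r * \<eta>)" if "0 < r" for c r \<eta> :: real
      using that by (auto intro!: derivative_eq_intros)
    then have d\<phi>: "(\<phi> has_vector_derivative exp (1 / 3 + \<bar>x\<bar>) * exp (- (R\<^sup>2) * \<eta>)) (at \<eta>)" for \<eta>
      unfolding \<phi>_def has_real_derivative_iff_has_vector_derivative[symmetric]
      using that by simp
    have "norm (P (of_real R + \<i> * of_real 1) - P (of_real R + \<i> * of_real 0)) \<le> \<phi> 1 - \<phi> 0"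
    proof (rule differentiable_bound_general)
      fix \<eta> :: real assume \<eta>: "0 < \<eta>" "\<eta> < 1"
      show "((\<lambda>\<eta>. P (of_real R + \<i> * of_real \<eta>)) has_vector_derivative
          \<i> * airy_phase x (of_real R + \<i> * of_real \<eta>)) (at \<eta>)" by (rule dP)
      show "(\<phi> has_vector_derivative exp (1 / 3 + \<bar>x\<bar>) * exp (- (R\<^sup>2) * \<eta>)) (at \<eta>)" by (rule d\<phi>)
      have "\<eta> ^ 3 \<le> 1" using \<eta> by (intro power_le_one) auto
      moreover have "- x * \<eta> \<le> \<bar>x\<bar> * 1"
        using \<eta> by (intro mult_mono) auto
      ultimately show "norm (\<i> * airy_phase x (of_real R + \<i> * of_real \<eta>))
          \<le> exp (1 / 3 + \<bar>x\<bar>) * exp (- (R\<^sup>2) * \<eta>)"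
        by (simp add: norm_mult norm_airy_phase mult.commute flip: exp_add)
    next
      show "continuous_on {0..1} (\<lambda>\<eta>. P (of_real R + \<i> * of_real \<eta>))"
        by (intro continuous_at_imp_continuous_on ballI has_vector_derivative_continuous[OF dP])
      show "continuous_on {0..1} \<phi>"
        unfolding \<phi>_def using that by (intro continuous_intros) auto
    qed simp
    also have "\<phi> 1 - \<phi> 0 \<le> exp (1 / 3 + \<bar>x\<bar>) / R\<^sup>2"
      by (simp add: \<phi>_def)
    finally show ?thesis by simp
  qed
  have "((\<lambda>R. P (of_real R + \<i>) - P (of_real R)) \<longlongrightarrow> 0) at_top"
  proof (rule Lim_null_comparison)
    show "\<forall>\<^sub>F R in at_top. norm (P (of_real R + \<i>) - P (of_real R)) \<le> exp (1 / 3 + \<bar>x\<bar>) / R\<^sup>2"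
      using eventually_gt_at_top[of 0] by eventually_elim (rule vertical)
    show "((\<lambda>R. exp (1 / 3 + \<bar>x\<bar>) / R\<^sup>2) \<longlongrightarrow> 0) at_top" by real_asymp
  qed
  from tendsto_diff[OF shifted this]
  have "((\<lambda>R. P (of_real R)) \<longlongrightarrow> P \<i> + airy_moment 0 x) at_top" by simp
  then have "((\<lambda>R. Re (P (of_real R)) - Re (P 0)) \<longlongrightarrow> Re (P \<i> + airy_moment 0 x) - Re (P 0)) at_top"
    by (intro tendsto_intros)
  moreover have "\<forall>\<^sub>F R in at_top. Re (P (of_real R)) - Re (P 0) = integral {0..R} (\<lambda>t. cos (t ^ 3 / 3 + x * t))"
    using eventually_ge_at_top[of 0] by eventually_elim (simp add: real_axis)
  ultimately have "((\<lambda>R. integral {0..R} (\<lambda>t. cos (t ^ 3 / 3 + x * t)))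
      \<longlongrightarrow> Re (P \<i> + airy_moment 0 x) - Re (P 0)) at_top"
    by (rule Lim_transform_eventually)
  \<comment> \<open>Convergence of the oscillatory integral has just been obtained from the shifted
    contour; this is what determines the value of \<open>Lim\<close>.\<close>
  then have "Lim at_top (\<lambda>R. integral {0..R} (\<lambda>t. cos (t ^ 3 / 3 + x * t)))
      = Re (P \<i> + airy_moment 0 x) - Re (P 0)"
    by (intro tendsto_Lim) auto
  then show ?thesis using corner by (simp add: airy_def airy_deriv_def)
qed

lemma deriv_airy: "deriv airy x = airy_deriv 1 x"
proof -
  have "airy = airy_deriv 0" by (simp add: fun_eq_iff airy_eq)
  then show ?thesis using DERIV_airy_deriv[of 0 x] by (simp add: DERIV_imp_deriv)
qed

section \<open>Decay of the Airy function and the integral form of the kernel\<close>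

lemma airy_deriv_decay: obtains C where "\<And>x. \<bar>airy_deriv n x\<bar> \<le> C * exp (- x)"
proof
  fix x
  have "\<bar>airy_deriv n x\<bar> \<le> norm (airy_moment n x) / pi"
    unfolding airy_deriv_def abs_divide by (intro divide_mono abs_Re_le_cmod) auto
  also have "\<dots> \<le> (LINT t|half_line 0. (1 + t\<^sup>2) ^ n * exp (- t\<^sup>2)) * exp (1 / 3 - x) / pi"
    by (intro divide_right_mono norm_airy_moment) simp
  also have "exp (1 / 3 - x) = exp (1 / 3) * exp (- x)" by (simp flip: exp_add)
  finally show "\<bar>airy_deriv n x\<bar>
      \<le> (LINT t|half_line 0. (1 + t\<^sup>2) ^ n * exp (- t\<^sup>2)) * exp (1 / 3) / pi * exp (- x)"
    by simp
qed

text \<open>The half-line Gaussian integral sqrt(pi)/2 gives the constant exp(1/3) / (2 sqrt(pi)).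
  Its numerical size matters, because the kernel bound and then the contraction depend on
  it.\<close>

lemma airy_bound: "\<bar>airy x\<bar> \<le> 3 / 4 * exp (- x)"
proof -
  have "(LINT t|half_line 0. exp (- t\<^sup>2)) = sqrt pi / 2"
    using has_bochner_integral_integral_eq[OF gaussian_moment_0]
    by (simp add: integral_half_line set_lebesgue_integral_def)
  then have "norm (airy_moment 0 x) \<le> sqrt pi / 2 * exp (1 / 3 - x)"
    using norm_airy_moment[of 0 x] by (simp only: power_0 mult_1_left)
  then have "\<bar>Re (airy_moment 0 x)\<bar> \<le> sqrt pi / 2 * exp (1 / 3 - x)"
    using abs_Re_le_cmod[of "airy_moment 0 x"] by linarith
  then have "\<bar>airy x\<bar> \<le> sqrt pi / 2 * exp (1 / 3 - x) / pi"
    unfolding airy_eq airy_deriv_def abs_divide by (intro divide_mono) auto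
  also have "\<dots> = exp (1 / 3) / (2 * sqrt pi) * exp (- x)"
    unfolding diff_conv_add_uminus exp_add by (simp add: field_simps)
  also have "\<dots> \<le> 3 / 4 * exp (- x)"
  proof (intro mult_right_mono)
    \<comment> \<open>Cubing reduces the bound on exp(1/3) to e \<le> 3 \<le> 27/8.\<close>
    have "exp (1 / 3 :: real) ^ 3 = exp 1" by (simp flip: exp_of_nat_mult)
    also have "\<dots> \<le> (3 / 2) ^ 3" using exp_le by (simp add: power3_eq_cube)
    finally have "exp (1 / 3 :: real) \<le> 3 / 2" by (rule iffD1[OF power_mono_iff, rotated 3]) auto
    moreover have "1 \<le> sqrt pi" using pi_ge_two by simp
    ultimately show "exp (1 / 3) / (2 * sqrt pi) \<le> 3 / 4"
      using frac_le[of "3 / 2" "exp (1 / 3)" 2 "2 * sqrt pi"] by simp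
  qed simp
  finally show ?thesis .
qed

lemma continuous_airy_deriv: "continuous_on S (airy_deriv n)"
  by (rule DERIV_continuous_on[OF has_field_derivative_at_within[OF DERIV_airy_deriv]])

text \<open>Shift both arguments of the numerator of the kernel by s - a and differentiate in s: the
  products of first derivatives cancel, and the Airy equation turns the rest into (t - x) Ai Ai. The
  shifted numerator tends to 0. Starting at \<open>a\<close> lets the integral run over the half
  line on which the operators act.\<close>

lemma airy_kernel_integral:
  assumes "x \<noteq> t"
  shows "airy_kernel x t = (LINT s|half_line a. airy (x + (s - a)) * airy (t + (s - a)))"
proof -
  define D where "D n y s = airy_deriv n (y + (s - a))" for n y s
  define F where "F s = D 0 x s * D 1 t s - D 1 x s * D 0 t s" for s
  define f where "f s = - (x - t) * (D 0 x s * D 0 t s)" for s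
  obtain C where C: "\<And>y. \<bar>airy_deriv 0 y\<bar> \<le> C * exp (- y)"
    by (rule airy_deriv_decay[of 0]) (rule that)
  obtain C' where C': "\<And>y. \<bar>airy_deriv 1 y\<bar> \<le> C' * exp (- y)"
    by (rule airy_deriv_decay[of 1]) (rule that)
  have prod_le: "\<bar>D m y s * D n z s\<bar> \<le> A * B * exp (2 * a - y - z) * exp (- 2 * s)"
    if "\<And>y. \<bar>airy_deriv m y\<bar> \<le> A * exp (- y)" "\<And>y. \<bar>airy_deriv n y\<bar> \<le> B * exp (- y)" for m n A B y z s
  proof -
    have "\<bar>D m y s * D n z s\<bar> \<le> (A * exp (- (y + (s - a)))) * (B * exp (- (z + (s - a))))"
      unfolding D_def abs_mult
      by (intro mult_mono that order_trans[OF abs_ge_zero that(1)] abs_ge_zero)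
    also have "\<dots> = A * B * (exp (- (y + (s - a))) * exp (- (z + (s - a))))" by (simp only: ac_simps)
    also have "exp (- (y + (s - a))) * exp (- (z + (s - a))) = exp (2 * a - y - z) * exp (- 2 * s)"
      unfolding exp_add[symmetric] by (rule arg_cong[of _ _ exp]) simp
    finally show ?thesis by (simp add: mult.assoc)
  qed
  have lim: "((\<lambda>s. D m y s * D n z s) \<longlongrightarrow> 0) at_top"
    if "\<And>y. \<bar>airy_deriv m y\<bar> \<le> A * exp (- y)" "\<And>y. \<bar>airy_deriv n y\<bar> \<le> B * exp (- y)" for m n A B y z
  proof (rule Lim_null_comparison)
    show "\<forall>\<^sub>F s in at_top. norm (D m y s * D n z s) \<le> A * B * exp (2 * a - y - z) * exp (- 2 * s)"
      using prod_le[OF that] by simp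
    show "((\<lambda>s. A * B * exp (2 * a - y - z) * exp (- 2 * s)) \<longlongrightarrow> 0) at_top"
      by (rule tendsto_mult_right_zero) real_asymp
  qed
  have cont: "continuous_on UNIV (D n y)" for n y
    unfolding D_def by (intro continuous_on_compose2[OF continuous_airy_deriv] continuous_intros) auto
  have int: "integrable (half_line a) f"
    unfolding f_def
  proof (rule integrable_mult_right, rule integrable_dominated)
    show "integrable (half_line a) (\<lambda>s. C * C * exp (2 * a - x - t) * exp (- 2 * s))"
      by (intro integrable_mult_right half_line_exp)
    show "(\<lambda>s. D 0 x s * D 0 t s) \<in> borel_measurable (half_line a)"
      by (intro borel_measurable_half_line borel_measurable_continuous_onI continuous_intros cont)
  qed (use prod_le[OF C C] in simp)
  have DERIV_D: "DERIV (D n y) s :> D (Suc n) y s" for n y s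
    unfolding D_def
  proof -
    have "DERIV (\<lambda>s. y + (s - a)) s :> 1" by (auto intro!: derivative_eq_intros)
    from DERIV_chain2[OF DERIV_airy_deriv this]
    show "DERIV (\<lambda>s. airy_deriv n (y + (s - a))) s :> airy_deriv (Suc n) (y + (s - a))" by simp
  qed
  have "(F \<longlongrightarrow> F a + (LINT s|half_line a. f s)) at_top"
  proof (rule half_line_FTC)
    show "(F has_vector_derivative f s) (at s)" for s
    proof -
      have "DERIV F s :> (D 1 x s * D 1 t s + D 2 t s * D 0 x s) - (D 2 x s * D 0 t s + D 1 t s * D 1 x s)"
        unfolding F_def
        using DERIV_D[of 0 x s] DERIV_D[of 0 t s] DERIV_D[of 1 x s] DERIV_D[of 1 t s]
        by (intro DERIV_diff DERIV_mult) (simp_all add: numeral_2_eq_2)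
      also have "(D 1 x s * D 1 t s + D 2 t s * D 0 x s) - (D 2 x s * D 0 t s + D 1 t s * D 1 x s) = f s"
        by (simp add: f_def D_def airy_deriv_2 algebra_simps)
      finally show ?thesis by (simp add: has_real_derivative_iff_has_vector_derivative)
    qed
    show "continuous_on UNIV f" unfolding f_def by (intro continuous_intros cont)
  qed (rule int)
  moreover have "(F \<longlongrightarrow> 0 - 0) at_top"
    unfolding F_def by (intro tendsto_diff lim[OF C C'] lim[OF C' C])
  ultimately have "F a + (LINT s|half_line a. f s) = 0"
    by (intro tendsto_unique[of at_top F]) auto
  moreover have "(LINT s|half_line a. f s) = - (x - t) * (LINT s|half_line a. D 0 x s * D 0 t s)"
    unfolding f_def by (rule integral_mult_right_zero)
  ultimately have "F a = (x - t) * (LINT s|half_line a. D 0 x s * D 0 t s)"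
    by (simp add: left_diff_distrib)
  moreover have "airy_kernel x t = F a / (x - t)"
    by (simp add: airy_kernel_def F_def D_def airy_eq deriv_airy)
  ultimately show ?thesis
    using assms by (simp add: D_def airy_eq)
qed

lemma airy_measurable [measurable]: "airy \<in> borel_measurable borel"
proof -
  have "airy = airy_deriv 0" by (simp add: fun_eq_iff airy_eq)
  then show ?thesis by (metis borel_measurable_continuous_onI continuous_airy_deriv)
qed

lemma deriv_airy_measurable [measurable]: "deriv airy \<in> borel_measurable borel"
proof -
  have "deriv airy = airy_deriv 1" by (simp add: fun_eq_iff deriv_airy)
  then show ?thesis by (metis borel_measurable_continuous_onI continuous_airy_deriv)
qed

section \<open>The Airy operator\<close>

lemma AE_half_line_neq: "AE t in half_line a. t \<noteq> x"
  unfolding half_line_def by (subst AE_restrict_space_iff) (use AE_lborel_singleton[of x] in auto)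

lemma weighted_half_line: "weighted_space (half_line \<zeta>) (\<lambda>x. exp (- x))"
proof (intro weighted_space.intro weighted_space_axioms.intro)
  show "sigma_finite_measure (half_line \<zeta>)"
    unfolding half_line_def
    by (intro sigma_finite_measure_restrict_space lborel.sigma_finite_measure_axioms) simp
  show "(\<lambda>x. exp (- x)) \<in> borel_measurable (half_line \<zeta>)"
    by (intro borel_measurable_half_line) measurable
  show "integrable (half_line \<zeta>) (\<lambda>x. (exp (- x))\<^sup>2)"
    using half_line_exp(1)[of \<zeta>] by (simp flip: exp_double)
qed simp

text \<open>The sign of \<zeta> enters here: the mass is exp(-2 \<zeta>)/2.\<close>

lemma half_line_mass:
  assumes "0 \<le> \<zeta>"
  shows "weighted_space.mass (half_line \<zeta>) (\<lambda>x. exp (- x)) \<le> 1 / 2"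
  using half_line_exp(2)[of \<zeta>] assms
  by (simp add: weighted_space.mass_def[OF weighted_half_line] flip: exp_double)

lemma half_line_pair_measurable:
  shows "fst \<in> borel_measurable (half_line a \<Otimes>\<^sub>M half_line a)"
    and "snd \<in> borel_measurable (half_line a \<Otimes>\<^sub>M half_line a)"
proof -
  have id [measurable]: "(\<lambda>x. x) \<in> borel_measurable (half_line a)"
    by (rule borel_measurable_half_line) simp
  show "fst \<in> borel_measurable (half_line a \<Otimes>\<^sub>M half_line a)"
    using measurable_compose[OF measurable_fst id] by simp
  show "snd \<in> borel_measurable (half_line a \<Otimes>\<^sub>M half_line a)"
    using measurable_compose[OF measurable_snd id] by simp
qed

section \<open>Bounds for the Airy kernel and for the kernel of its square root\<close>

lemma airy_kernel_commute: "airy_kernel x t = airy_kernel t x"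
  unfolding airy_kernel_def by (subst minus_divide_divide[symmetric]) (simp add: mult.commute)

text \<open>Squaring 3/4 and integrating exp(-2s) gives 9/32. It is enlarged to 3/8, the largest
  value with which the ball of radius 1/2 is still preserved by the estimates for the
  factorization.\<close>

lemma airy_kernel_le: "\<bar>airy_kernel x t\<bar> \<le> 3 / 8 * (exp (- x) * exp (- t))"
proof (cases "x = t")
  case True
  then show ?thesis by (simp add: airy_kernel_def)
next
  case False
  have le: "\<bar>airy (x + s) * airy (t + s)\<bar> \<le> 9 / 16 * exp (- x - t) * exp (- 2 * s)" for s
  proof -
    have "\<bar>airy (x + s) * airy (t + s)\<bar> \<le> (3 / 4 * exp (- (x + s))) * (3 / 4 * exp (- (t + s)))"
      unfolding abs_mult by (intro mult_mono airy_bound) auto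
    also have "\<dots> = 9 / 16 * (exp (- (x + s)) * exp (- (t + s)))" by simp
    also have "exp (- (x + s)) * exp (- (t + s)) = exp (- x - t) * exp (- 2 * s)"
      unfolding exp_add[symmetric] by (rule arg_cong[of _ _ exp]) simp
    finally show ?thesis by simp
  qed
  have "integrable (half_line 0) (\<lambda>s. airy (x + s) * airy (t + s))"
  proof (rule integrable_dominated)
    show "integrable (half_line 0) (\<lambda>s. 9 / 16 * exp (- x - t) * exp (- 2 * s))"
      by (intro integrable_mult_right half_line_exp)
    show "(\<lambda>s. airy (x + s) * airy (t + s)) \<in> borel_measurable (half_line 0)"
      by (intro borel_measurable_half_line) measurable
  qed (use le in simp)
  then have "\<bar>airy_kernel x t\<bar> \<le> (LINT s|half_line 0. 9 / 16 * exp (- x - t) * exp (- 2 * s))"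
    unfolding airy_kernel_integral[OF False, of 0] real_norm_def[symmetric] diff_zero
    by (rule norm_integral_le[OF _ integrable_mult_right[OF half_line_exp(1)]]) (use le in simp)
  also have "\<dots> = 9 / 32 * exp (- x - t)"
    using half_line_exp(2)[of 0] by simp
  also have "exp (- x - t) = exp (- x) * exp (- t)" by (simp flip: exp_add)
  finally show ?thesis
    using mult_nonneg_nonneg[of "exp (- x)" "exp (- t)"] by simp
qed

lemma airy_kernel_bounded: "kernel_bounded (half_line \<zeta>) (\<lambda>x t. exp (- x) * exp (- t)) (3 / 8) airy_kernel"
  unfolding kernel_bounded_def
proof (intro conjI ballI airy_kernel_le)
  note [measurable] = half_line_pair_measurable
  show "(\<lambda>(x, t). airy_kernel x t) \<in> borel_measurable (half_line \<zeta> \<Otimes>\<^sub>M half_line \<zeta>)"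
    unfolding airy_kernel_def by measurable
qed

text \<open>The kernel of A. The exponential bound factors exactly into the weights; the constant
  grows with \<zeta>, which is harmless because the trace class property needs only
  finiteness.\<close>

lemma shifted_airy_bounded:
  "kernel_bounded (half_line \<zeta>) (\<lambda>x t. exp (- x) * exp (- t)) (3 / 4 * exp \<zeta>) (\<lambda>x t. airy (x + (t - \<zeta>)))"
  unfolding kernel_bounded_def
proof (intro conjI ballI)
  note [measurable] = half_line_pair_measurable
  show "(\<lambda>(x, t). airy (x + (t - \<zeta>))) \<in> borel_measurable (half_line \<zeta> \<Otimes>\<^sub>M half_line \<zeta>)"
    by measurable
  show "\<bar>airy (x + (t - \<zeta>))\<bar> \<le> 3 / 4 * exp \<zeta> * (exp (- x) * exp (- t))" for x t
  proof -
    have "exp (- (x + (t - \<zeta>))) = exp \<zeta> * (exp (- x) * exp (- t))"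
      unfolding exp_add[symmetric] by (rule arg_cong[of _ _ exp]) simp
    then show ?thesis using airy_bound[of "x + (t - \<zeta>)"] by simp
  qed
qed

text \<open>For a Volterra kernel \<open>v\<close>, the equation \<open>(I + V)\<^sup>* (I + V) = I - K\<close> is the nonlinear
  equation below, whose right-hand side is a contraction on the ball of radius \<open>1/2\<close>.\<close>

lemma volterra_factor_kernel:
  assumes \<zeta>: "0 \<le> \<zeta>"
  obtains v where "kernel_bounded (half_line \<zeta>) (\<lambda>x t. exp (- x) * exp (- t)) (1 / 2) v"
    and "\<And>x t. \<zeta> < x \<Longrightarrow> x \<le> t \<Longrightarrow> v x t = 0"
    and "\<And>x t. \<zeta> < t \<Longrightarrow> t < x \<Longrightarrow>
      v x t = - airy_kernel x t - kernel_comp (half_line \<zeta>) (\<lambda>x t. v t x) v x t"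
proof -
  interpret weighted_space "half_line \<zeta>" "\<lambda>x. exp (- x)" by (rule weighted_half_line)
  let ?M = "half_line \<zeta>"
  note k = airy_kernel_bounded[of \<zeta>]
  \<comment> \<open>Vanishing on and above the diagonal, this majorant keeps every iterate a
    Volterra kernel.\<close>
  define b where "b x t = (if t < x then exp (- x) * exp (- t) else 0)" for x t :: real
  \<comment> \<open>The kernel of the adjoint of U followed on the right by V.\<close>
  define Q where "Q u v = kernel_comp ?M (\<lambda>x t. u t x) v" for u v
  define \<Phi> where "\<Phi> v = (\<lambda>x t. if t < x then - airy_kernel x t - Q v v x t else 0)" for v
  have dom: "dominated C v" if "kernel_bounded ?M b C v" "0 \<le> C" for C v
    unfolding kernel_bounded_def
  proof (intro conjI ballI)
    show "(\<lambda>(x, t). v x t) \<in> borel_measurable (?M \<Otimes>\<^sub>M ?M)"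
      using that(1) by (simp add: kernel_bounded_def)
    fix x t assume xt: "x \<in> space ?M" "t \<in> space ?M"
    have "b x t \<le> exp (- x) * exp (- t)" by (simp add: b_def)
    from mult_left_mono[OF this that(2)] show "\<bar>v x t\<bar> \<le> C * (exp (- x) * exp (- t))"
      using kernel_boundedD[OF that(1) xt] by linarith
  qed
  have Q_le: "\<bar>Q u v x t\<bar> \<le> C * D / 2 * (exp (- x) * exp (- t))"
    if "dominated C u" "dominated D v" "0 \<le> C" "0 \<le> D" "x \<in> space ?M" "t \<in> space ?M" for C D u v x t
  proof -
    have "\<bar>Q u v x t\<bar> \<le> C * D * mass * (exp (- x) * exp (- t))"
      unfolding Q_def by (rule kernel_comp_integrable(2)[OF dominated_transpose[OF that(1)] that(2-)])
    also have "\<dots> \<le> C * D * (1 / 2) * (exp (- x) * exp (- t))"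
      using that half_line_mass[OF \<zeta>] by (intro mult_right_mono mult_left_mono) auto
    finally show ?thesis by simp
  qed
  obtain v where v: "kernel_bounded ?M b (1 / 2) v"
    and fix_v: "\<And>x t. x \<in> space ?M \<Longrightarrow> t \<in> space ?M \<Longrightarrow> \<Phi> v x t = v x t"
  proof (rule kernel_fixed_point[of ?M b "1 / 2" "1 / 2" \<Phi>])
    show "kernel_bounded ?M b (1 / 2) (\<Phi> v)" if v: "kernel_bounded ?M b (1 / 2) v" for v
      unfolding kernel_bounded_def
    proof (intro conjI ballI)
      have d: "dominated (1 / 2) v" using dom[OF v] by simp
      note [measurable] = half_line_pair_measurable
      have [measurable]: "(\<lambda>p. Q v v (fst p) (snd p)) \<in> borel_measurable (?M \<Otimes>\<^sub>M ?M)"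
        using kernel_comp_measurable[OF dominated_transpose[OF d] v] by (simp add: Q_def case_prod_beta')
      have [measurable]: "(\<lambda>p. airy_kernel (fst p) (snd p)) \<in> borel_measurable (?M \<Otimes>\<^sub>M ?M)"
        using k by (simp add: kernel_bounded_def case_prod_beta')
      show "(\<lambda>(x, t). \<Phi> v x t) \<in> borel_measurable (?M \<Otimes>\<^sub>M ?M)"
        unfolding \<Phi>_def case_prod_beta' by measurable
      fix x t assume xt: "x \<in> space ?M" "t \<in> space ?M"
      have q: "\<bar>Q v v x t\<bar> \<le> 1 / 8 * (exp (- x) * exp (- t))"
        using Q_le[OF d d _ _ xt] by simp
      \<comment> \<open>The second summand is (1/2)^2 times the bound 1/2 for the mass; the sum is
        exactly the radius 1/2.\<close>
      have "\<bar>- airy_kernel x t - Q v v x t\<bar> \<le> 3 / 8 * (exp (- x) * exp (- t)) + 1 / 8 * (exp (- x) * exp (- t))"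
        using airy_kernel_le[of x t] q by linarith
      then show "\<bar>\<Phi> v x t\<bar> \<le> 1 / 2 * b x t" by (simp add: \<Phi>_def b_def mult.commute)
    qed
    show "\<forall>x\<in>space ?M. \<forall>t\<in>space ?M. \<bar>\<Phi> u x t - \<Phi> v x t\<bar> \<le> 1 / 2 * d * b x t"
      if u: "kernel_bounded ?M b (1 / 2) u" and v: "kernel_bounded ?M b (1 / 2) v" and d: "0 \<le> d"
        and le: "\<forall>x\<in>space ?M. \<forall>t\<in>space ?M. \<bar>u x t - v x t\<bar> \<le> d * b x t" for u v d
    proof (intro ballI)
      fix x t assume xt: "x \<in> space ?M" "t \<in> space ?M"
      have du: "dominated (1 / 2) u" and dv: "dominated (1 / 2) v" using dom[OF u] dom[OF v] by auto
      note [measurable] = kernel_bounded_measurable[OF u] kernel_bounded_measurable[OF v]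
      have "kernel_bounded ?M b d (\<lambda>x t. u x t - v x t)"
        unfolding kernel_bounded_def
      proof (intro conjI)
        show "(\<lambda>(x, t). u x t - v x t) \<in> borel_measurable (?M \<Otimes>\<^sub>M ?M)" by measurable
      qed (rule le)
      then have dd: "dominated d (\<lambda>x t. u x t - v x t)" by (rule dom[OF _ d])
      note int = kernel_comp_integrable(1)[OF dominated_transpose _ _ _ xt]
      \<comment> \<open>Bilinearity splits the difference into two terms, each bounded by d times
        the radius 1/2 times the mass bound 1/2. Together they give the contraction factor
        1/2.\<close>
      have "Q u u x t - Q v v x t
          = Q (\<lambda>x t. u x t - v x t) u x t + Q v (\<lambda>x t. u x t - v x t) x t"
        using int[OF du du] int[OF dv dv] int[OF dv du]
        by (simp add: Q_def kernel_comp_def left_diff_distrib right_diff_distrib)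
      moreover have "\<bar>Q (\<lambda>x t. u x t - v x t) u x t\<bar> \<le> d / 4 * (exp (- x) * exp (- t))"
        using Q_le[OF dd du d _ xt] by simp
      moreover have "\<bar>Q v (\<lambda>x t. u x t - v x t) x t\<bar> \<le> d / 4 * (exp (- x) * exp (- t))"
        using Q_le[OF dv dd _ d xt] by simp
      ultimately have "\<bar>Q u u x t - Q v v x t\<bar> \<le> d / 2 * (exp (- x) * exp (- t))" by linarith
      then show "\<bar>\<Phi> u x t - \<Phi> v x t\<bar> \<le> 1 / 2 * d * b x t"
        by (simp add: \<Phi>_def b_def abs_minus_commute)
    qed
  qed (auto simp: b_def intro: that)
  show ?thesis
  proof (rule that)
    show "dominated (1 / 2) v" using dom[OF v] by simp
    show "v x t = 0" if "\<zeta> < x" "x \<le> t" for x t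
      using fix_v[of x t] that by (simp add: \<Phi>_def)
    show "v x t = - airy_kernel x t - kernel_comp ?M (\<lambda>x t. v t x) v x t" if "\<zeta> < t" "t < x" for x t
      using fix_v[of x t] that by (simp add: \<Phi>_def Q_def)
  qed
qed

theorem proposition6p19:
  fixes \<zeta> :: real
  assumes "\<zeta> > 0"
  shows "l2_positive (half_line \<zeta>) (S_op \<zeta>) \<and>
         l2_invertible (half_line \<zeta>) (S_op \<zeta>) \<and>
         factorable \<zeta> (S_op \<zeta>) \<and>
         l2_trace_class (half_line \<zeta>) (K_op \<zeta>)"
proof -
  have \<zeta>: "0 \<le> \<zeta>" using assms by simp
  interpret weighted_space "half_line \<zeta>" "\<lambda>x. exp (- x)" by (rule weighted_half_line)
  let ?M = "half_line \<zeta>"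
  have mass: "mass \<le> 1 / 2" by (rule half_line_mass[OF \<zeta>])
  note k = airy_kernel_bounded[of \<zeta>]
  have nk: "dominated (3 / 8) (\<lambda>x t. - airy_kernel x t)"
    unfolding kernel_bounded_def
  proof (intro conjI ballI)
    note [measurable] = kernel_bounded_measurable[OF k]
    show "(\<lambda>(x, t). - airy_kernel x t) \<in> borel_measurable (?M \<Otimes>\<^sub>M ?M)" by measurable
    show "\<bar>- airy_kernel x t\<bar> \<le> 3 / 8 * (exp (- x) * exp (- t))" for x t
      using airy_kernel_le[of x t] by (simp only: abs_minus_cancel)
  qed
  have S_eq: "S_op \<zeta> = id_plus (\<lambda>x t. - airy_kernel x t)"
    by (simp add: fun_eq_iff S_op_def id_plus_def int_op_def)
  have K_eq: "K_op \<zeta> = int_op ?M airy_kernel"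
    by (simp add: fun_eq_iff K_op_def S_op_def int_op_def)
  have S_bounded: "l2_bounded_op ?M (S_op \<zeta>)"
    unfolding S_eq by (rule id_plus_bounded[OF nk])

  obtain v where v: "dominated (1 / 2) v" and v_0: "\<And>x t. \<zeta> < x \<Longrightarrow> x \<le> t \<Longrightarrow> v x t = 0"
    and v_eq: "\<And>x t. \<zeta> < t \<Longrightarrow> t < x \<Longrightarrow>
      v x t = - airy_kernel x t - kernel_comp ?M (\<lambda>x t. v t x) v x t"
    by (rule volterra_factor_kernel[OF \<zeta>]) (rule that)
  \<comment> \<open>Transitivity of the support relation makes the resolvent of V a Volterra kernel
    too, so that the inverse of I + V is also triangular.\<close>
  have trans_v: "transp (\<lambda>x t. t < (x :: real))" by (auto intro: transpI)
  obtain r E where r: "0 \<le> E" "dominated E r" "l2_inverse_of ?M (id_plus v) (id_plus r)"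
    and r_0: "\<And>x t. x \<in> space ?M \<Longrightarrow> t \<in> space ?M \<Longrightarrow> \<not> t < x \<Longrightarrow> r x t = 0"
  proof (rule id_plus_inverse[OF v _ _ trans_v])
    show "2 * (1 / 2 * mass) < 1" using mass by simp
    show "v x t = 0" if "x \<in> space ?M" "t \<in> space ?M" "\<not> t < x" for x t
      using v_0 that by auto
  qed (simp, rule that)
  have v': "dominated (1 / 2) (\<lambda>x t. v t x)" by (rule dominated_transpose[OF v])
  let ?c = "kernel_comp ?M (\<lambda>x t. v t x) v"
  have c_sym: "?c x t = ?c t x" for x t
    by (simp add: kernel_comp_def mult.commute)
  \<comment> \<open>For t < x the term \<open>v t x\<close> vanishes and this is the fixed point
    equation; for x < t symmetry of both sides applies. On the diagonal \<open>v\<close> and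
    \<open>airy_kernel\<close> are 0 but \<open>?c x x\<close> need not be, so t = x is
    excluded.\<close>
  have factor: "v t x + v x t + ?c x t = - airy_kernel x t" if "\<zeta> < x" "\<zeta> < t" "t \<noteq> x" for x t
  proof (cases "t < x")
    case True
    then show ?thesis using v_eq[of t x] v_0[of t x] that by simp
  next
    case False
    then show ?thesis
      using v_eq[of x t] v_0[of x t] that c_sym[of x t] airy_kernel_commute[of x t] by simp
  qed
  have S_factor: "l2_op_eq ?M (S_op \<zeta>) (id_plus (\<lambda>x t. v t x) \<circ> id_plus v)"
    unfolding l2_op_eq_def
  proof (intro ballI AE_I2)
    fix f x assume f: "f \<in> L2 ?M" and x: "x \<in> space ?M"
    have sum: "dominated (1 / 2 + 1 / 2 + 1 / 2 * (1 / 2) * mass) (\<lambda>x t. v t x + v x t + ?c x t)"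
      by (intro dominated_add v v' dominated_comp) auto
    have "int_op ?M (\<lambda>x t. - airy_kernel x t) f x = int_op ?M (\<lambda>x t. v t x + v x t + ?c x t) f x"
      unfolding int_op_def
    proof (rule Bochner_Integration.integral_cong_AE)
      show "AE t in ?M. of_real (- airy_kernel x t) * f t = of_real (v t x + v x t + ?c x t) * f t"
        using AE_half_line_neq[of x \<zeta>] AE_space[of ?M]
      proof eventually_elim
        case (elim t)
        then show ?case using factor[of x t] x by simp
      qed
    qed (use int_op_integrable[OF nk f x] int_op_integrable[OF sum f x] in
        \<open>auto dest: borel_measurable_integrable\<close>)
    then show "S_op \<zeta> f x = (id_plus (\<lambda>x t. v t x) \<circ> id_plus v) f x"
      using id_plus_comp[OF v' v _ _ f x] by (simp add: S_eq id_plus_def)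
  qed
  have adj: "l2_adjoint_of ?M (id_plus v) (id_plus (\<lambda>x t. v t x))"
    by (rule id_plus_adjoint[OF v]) simp
  \<comment> \<open>For x < \<mu> the cutoff removes all t < \<mu>, and for the remaining t, which
    exceed x, the kernel vanishes.\<close>
  have tri: "triangular \<zeta> (id_plus u)"
    if u: "\<And>x t. x \<in> space ?M \<Longrightarrow> t \<in> space ?M \<Longrightarrow> \<not> t < x \<Longrightarrow> u x t = 0" for u
    unfolding triangular_def l2_op_eq_def
  proof (intro allI impI ballI AE_I2)
    fix \<mu> f x assume x: "x \<in> space ?M"
    show "(id_plus u \<circ> cutoff \<mu>) f x = (cutoff \<mu> \<circ> id_plus u \<circ> cutoff \<mu>) f x"
    proof (cases "\<mu> \<le> x")
      case True
      then show ?thesis by (simp add: cutoff_def)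
    next
      case False
      have "int_op ?M u (cutoff \<mu> f) x = (LINT t|?M. 0)"
        unfolding int_op_def
        by (intro Bochner_Integration.integral_cong) (use u x False in \<open>auto simp: cutoff_def\<close>)
      then show ?thesis using False by (simp add: cutoff_def id_plus_def)
    qed
  qed
  have factorable: "factorable \<zeta> (S_op \<zeta>)"
    unfolding factorable_def
    using id_plus_bounded[OF v] adj r(3) S_factor tri[of v] tri[of r] v_0 r_0
    by (intro exI[of _ "id_plus v"] exI[of _ "id_plus (\<lambda>x t. v t x)"] exI[of _ "id_plus r"]) auto

  \<comment> \<open>The inverse of S comes from the smallness of K, with the trivial relation since
    the Airy kernel has no triangular support.\<close>
  obtain s where s: "l2_inverse_of ?M (S_op \<zeta>) (id_plus s)"
    unfolding S_eq
  proof (rule id_plus_inverse[OF nk, of "\<lambda>_ _. True"])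
    show "2 * (3 / 8 * mass) < 1" using mass by simp
  qed (auto intro: that transpI)
  have invertible: "l2_invertible ?M (S_op \<zeta>)"
    unfolding l2_invertible_def using S_bounded s by blast

  \<comment> \<open>This kernel is symmetric, so its composition with itself is the integral of Ai(x
    + s - \<zeta>) Ai(t + s - \<zeta>) over s > \<zeta>, which is the Airy kernel off the
    diagonal.\<close>
  let ?a = "\<lambda>x t. airy (x + (t - \<zeta>))"
  have "l2_op_eq ?M (K_op \<zeta>) (int_op ?M ?a \<circ> int_op ?M ?a)"
    unfolding l2_op_eq_def
  proof (intro ballI AE_I2)
    fix f x assume f: "f \<in> L2 ?M" and x: "x \<in> space ?M"
    note a = shifted_airy_bounded[of \<zeta>]
    have "K_op \<zeta> f x = int_op ?M (kernel_comp ?M ?a ?a) f x"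
      unfolding K_eq int_op_def
    proof (rule Bochner_Integration.integral_cong_AE)
      show "AE t in ?M. of_real (airy_kernel x t) * f t = of_real (kernel_comp ?M ?a ?a x t) * f t"
        using AE_half_line_neq[of x \<zeta>]
      proof eventually_elim
        case (elim t)
        have "kernel_comp ?M ?a ?a x t = (LINT s|?M. airy (x + (s - \<zeta>)) * airy (t + (s - \<zeta>)))"
          unfolding kernel_comp_def by (simp add: add_diff_eq add.commute)
        then show ?case
          using airy_kernel_integral[of x t \<zeta>] elim by simp
      qed
    qed (use int_op_integrable[OF k f x] int_op_integrable[OF dominated_comp[OF a a] f x] in
        \<open>auto dest: borel_measurable_integrable\<close>)
    then show "K_op \<zeta> f x = (int_op ?M ?a \<circ> int_op ?M ?a) f x"
      using int_op_comp[OF a a _ _ f x] by simp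
  qed
  then have "l2_trace_class ?M (K_op \<zeta>)"
    using int_op_bounded[OF k]
    by (intro int_op_square_trace_class[OF shifted_airy_bounded]) (auto simp: K_eq algebra_simps)
  moreover have "l2_positive ?M (S_op \<zeta>)"
    by (rule l2_positive_factor(2)[OF S_bounded id_plus_bounded[OF v] adj S_factor])
  ultimately show ?thesis using invertible factorable by blast
qed

end
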